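(* Let $G$ be a quasitriangular Poisson–Lie group with quasitriangular structure $r\in\mathfrak g\otimes\mathfrak g$, quantised to a coquasitriangular Hopf algebra $C_\hbar(G)$ by a cochain twist of the classical function Hopf algebra $C(G)$, where the cochain has the form $F_\hbar=1\otimes1+\hbar f+O(\hbar^2)\in U(\mathfrak g)\otimes U(\mathfrak g)$ with $r=f_{21}-f+r_+$ (so that $r_-=f_{21}-f$). Equip $C_\hbar(G)$ with the differential calculus obtained by twisting the classical differential calculus by $F_\hbar$ (see context). Then the preconnection obtained by semiclassicalising this quantum differential calculus is the canonical one, $\hat\Xi=0$; that is, in the twisted calculus $a\bullet\tau-\tau\bullet a=\hbar\,\gamma(a,\tau)+O(\hbar^2)$ with $$\gamma(a,\tau)=(a\triangleleft r_-^{[1]})(\tau\triangleleft r_-^{[2]})-(r_-^{[1]}\triangleright a)(r_-^{[2]}\triangleright\tau).$$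
   Context: Twisting. For a Hopf algebra $H$ with bicovariant calculus $\Omega^1$ (left and right coactions $\Delta_L,\Delta_R$) and a convolution-invertible $2$-cochain $F:H\otimes H\to k$ with $F(1\otimes a)=\epsilon(a)$, the twisted products are $a\bullet b=F(a_{(1)}\otimes b_{(1)})\,a_{(2)}b_{(2)}\,F^{-1}(a_{(3)}\otimes b_{(3)})$, $a\bullet\tau=F(a_{(1)}\otimes\tau_{(1)})\,a_{(2)}\tau_{(2)}\,F^{-1}(a_{(3)}\otimes\tau_{(3)})$, $\tau\bullet a=F(\tau_{(1)}\otimes a_{(1)})\,\tau_{(2)}a_{(2)}\,F^{-1}(\tau_{(3)}\otimes a_{(3)})$, where $(\mathrm{id}\otimes\Delta_R)\Delta_L\tau=\tau_{(1)}\otimes\tau_{(2)}\otimes\tau_{(3)}\in H\otimes\Omega^1\otimes H$; $\mathrm{d}$ is unchanged. Here $H=C(G)$ is a suitable Hopf algebra of functions on $G$, $(\Delta a)(g,h)=a(gh)$, with its classical $1$-forms and translation coactions $(\Delta_L\tau)(g,h)=L_g^*(\tau(gh))$ and similarly $\Delta_R$, and $F=F_\hbar$ is evaluated via the pairing of $U(\mathfrak g)\otimes U(\mathfrak g)$ with $C(G)\otimes C(G)$. (The twisted function algebra $C_\hbar(G)$ is an ordinary associative Hopf algebra, but the bimodule need only be quasi-associative.) Poisson–Lie notation. $\delta v=\mathrm{ad}_v(r)$, where $r$ satisfies $[r_{12},r_{13}]+[r_{12},r_{23}]+[r_{13},r_{23}]=0$; $r_\pm=\frac12(r\pm r_{21})$,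 $r_+$ is ad-invariant, $r_-=r_-^{[1]}\otimes r_-^{[2]}$ (summation understood). Actions: $(g\triangleright a)(h)=a(g^{-1}h)$, $(g\triangleright\tau)(h)=L^*_{g^{-1}}(\tau(g^{-1}h))$, $(a\triangleleft g)(h)=a(hg^{-1})$, $(\tau\triangleleft g)(h)=R^*_{g^{-1}}(\tau(hg^{-1}))$, and $v\triangleright$, $\triangleleft v$ ($v\in\mathfrak g$) are the infinitesimal actions. Canonical preconnection: for a left invariant preconnection $\gamma$ on $G$ one writes, with $\tilde\tau(g)(v)=\tau(g)(gv)$ and $\tilde\gamma(a,\tilde\tau)=\widetilde{\gamma(a,\tau)}$, $\tilde\gamma(a,s)(g)=\{a,s\}(g)+\Xi(\hat L_a(g),s(g))$, $\hat L_a(g)(v)=a'(g;gv)$ (derivative of $a$ at $g$ along $gv$), and $\hat\Xi(\phi,\psi)=\Xi(\phi,\psi)-\phi(r_-^{[1]})\mathrm{ad}^*_{r_-^{[2]}}\psi$ with $(\mathrm{ad}^*_v\psi)(w)=\psi([w,v])$; the canonical preconnection is the one with $\hat\Xi=0$, which is given by the displayed formula for $\gamma$. *)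

theory Defs
  imports
    "HOL-Analysis.Analysis"
    "HOL-Algebra.Group"
    "HOL-Library.Poly_Mapping"
    "HOL-Computational_Algebra.Formal_Power_Series"
begin

section \<open>Lie groups\<close>

text \<open>Only meaningful for open \<^term>\<open>S\<close>: the Frechet derivatives are full (not relative) ones.\<close>

fun Ck_on :: "nat \<Rightarrow> 'a::real_normed_vector set \<Rightarrow> ('a \<Rightarrow> 'b::real_normed_vector) \<Rightarrow> bool" where
  "Ck_on 0 S f \<longleftrightarrow> continuous_on S f"
| "Ck_on (Suc n) S f \<longleftrightarrow>
     (\<forall>x\<in>S. f differentiable (at x)) \<and> (\<forall>v. Ck_on n S (\<lambda>x. frechet_derivative f (at x) v))"

definition smooth_on :: "'a::real_normed_vector set \<Rightarrow> ('a \<Rightarrow> 'b::real_normed_vector) \<Rightarrow> bool" where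
  "smooth_on S f \<longleftrightarrow> (\<forall>n. Ck_on n S f)"

record ('g, 'e) lie_data = "'g monoid" +
  atlas :: "('g set \<times> ('g \<Rightarrow> 'e)) set"

text \<open>The underlying set is a whole type. Since a \<open>euclidean_space\<close> has positive dimension,
  Lie groups of dimension 0, that is countable discrete groups, are admitted separately: they carry
  the empty atlas, for which every function is smooth (see \<open>smooth_fun\<close> below).\<close>

locale lie_group = group G
  for G :: "('g::{t2_space, second_countable_topology}, 'e::euclidean_space, 'm) lie_data_scheme"
    (structure) +
  assumes carrier_UNIV: "carrier G = UNIV"
    and covering: "(\<Union>(U, \<phi>)\<in>atlas G. U) = UNIV \<or> atlas G = {} \<and> (\<forall>S::'g set. open S)"
    and chart: "(U, \<phi>) \<in> atlas G \<Longrightarrow>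
      open U \<and> open (\<phi> ` U) \<and> homeomorphism U (\<phi> ` U) \<phi> (inv_into U \<phi>)"
    and compatible: "(U, \<phi>) \<in> atlas G \<Longrightarrow> (V, \<psi>) \<in> atlas G \<Longrightarrow>
      smooth_on (\<phi> ` (U \<inter> V)) (\<psi> \<circ> inv_into U \<phi>)"
    and continuous_mult: "continuous_on UNIV (\<lambda>(g, h). g \<otimes> h)"
    and continuous_inv: "continuous_on UNIV (\<lambda>g. inv\<^bsub>G\<^esub> g)"
    and smooth_mult: "(U, \<phi>) \<in> atlas G \<Longrightarrow> (V, \<psi>) \<in> atlas G \<Longrightarrow> (W, \<eta>) \<in> atlas G \<Longrightarrow>
      smooth_on {(x, y). x \<in> \<phi> ` U \<and> y \<in> \<psi> ` V \<and> inv_into U \<phi> x \<otimes> inv_into V \<psi> y \<in> W}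
        (\<lambda>(x, y). \<eta> (inv_into U \<phi> x \<otimes> inv_into V \<psi> y))"
    and smooth_inv: "(U, \<phi>) \<in> atlas G \<Longrightarrow> (W, \<eta>) \<in> atlas G \<Longrightarrow>
      smooth_on {x. x \<in> \<phi> ` U \<and> inv\<^bsub>G\<^esub> (inv_into U \<phi> x) \<in> W}
        (\<lambda>x. \<eta> (inv\<^bsub>G\<^esub> (inv_into U \<phi> x)))"

definition smooth_fun :: "('g, 'e::euclidean_space, 'm) lie_data_scheme \<Rightarrow> ('g \<Rightarrow> real) \<Rightarrow> bool" where
  "smooth_fun G f \<longleftrightarrow> (\<forall>(U, \<phi>)\<in>atlas G. smooth_on (\<phi> ` U) (f \<circ> inv_into U \<phi>))"

text \<open>Tangent vectors are derivations of the algebra of smooth functions at a point; being total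
  functionals, they are normalised to vanish on non-smooth functions.\<close>

type_synonym 'g tvec = "('g \<Rightarrow> real) \<Rightarrow> real"

definition tangent :: "('g, 'e::euclidean_space, 'm) lie_data_scheme \<Rightarrow> 'g \<Rightarrow> 'g tvec set" where
  "tangent G g = {x.
     (\<forall>a b \<alpha> \<beta>. smooth_fun G a \<longrightarrow> smooth_fun G b \<longrightarrow>
        x (\<lambda>h. \<alpha> * a h + \<beta> * b h) = \<alpha> * x a + \<beta> * x b) \<and>
     (\<forall>a b. smooth_fun G a \<longrightarrow> smooth_fun G b \<longrightarrow> x (\<lambda>h. a h * b h) = a g * x b + x a * b g) \<and>
     (\<forall>f. \<not> smooth_fun G f \<longrightarrow> x f = 0)}"

definition lie_alg :: "('g, 'e::euclidean_space, 'm) lie_data_scheme \<Rightarrow> 'g tvec set" where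
  "lie_alg G = tangent G \<one>\<^bsub>G\<^esub>"

text \<open>\<open>lpush G g\<close> is the differential of \<open>L\<^sub>g\<close>, so \<open>lpush G g v\<close> is the vector \<open>gv\<close>;
  \<open>rpush G g\<close> is the differential of \<open>R\<^sub>g\<close>.\<close>

definition lpush :: "('g, 'm) monoid_scheme \<Rightarrow> 'g \<Rightarrow> 'g tvec \<Rightarrow> 'g tvec" where
  "lpush G g x = (\<lambda>f. x (\<lambda>h. f (g \<otimes>\<^bsub>G\<^esub> h)))"

definition rpush :: "('g, 'm) monoid_scheme \<Rightarrow> 'g \<Rightarrow> 'g tvec \<Rightarrow> 'g tvec" where
  "rpush G g x = (\<lambda>f. x (\<lambda>h. f (h \<otimes>\<^bsub>G\<^esub> g)))"

text \<open>The bracket of the left invariant vector fields \<open>g \<mapsto> gv\<close>, \<open>g \<mapsto> gw\<close>, evaluated at the unit.\<close>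

definition lie_bracket ::
  "('g, 'e::euclidean_space, 'm) lie_data_scheme \<Rightarrow> 'g tvec \<Rightarrow> 'g tvec \<Rightarrow> 'g tvec" where
  "lie_bracket G v w = (\<lambda>f. if smooth_fun G f
     then v (\<lambda>g. lpush G g w f) - w (\<lambda>g. lpush G g v f) else 0)"

text \<open>Elements of the dual of the Lie algebra are functionals of which only the values on
  \<^term>\<open>lie_alg G\<close> matter.\<close>

definition lie_dual :: "('g, 'e::euclidean_space, 'm) lie_data_scheme \<Rightarrow> ('g tvec \<Rightarrow> real) set" where
  "lie_dual G = {\<phi>. \<forall>v\<in>lie_alg G. \<forall>w\<in>lie_alg G. \<forall>\<alpha> \<beta>.
     \<phi> (\<lambda>f. \<alpha> * v f + \<beta> * w f) = \<alpha> * \<phi> v + \<beta> * \<phi> w}"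


section \<open>Tensors over the Lie algebra and its enveloping algebra\<close>

text \<open>Tensors are represented by finite formal linear combinations of elementary tensors.\<close>

definition tmap :: "('a \<Rightarrow> 'b) \<Rightarrow> ('a \<Rightarrow>\<^sub>0 real) \<Rightarrow> ('b \<Rightarrow>\<^sub>0 real)" where
  "tmap h t = (\<Sum>p\<in>Poly_Mapping.keys t. Poly_Mapping.single (h p) (Poly_Mapping.lookup t p))"

definition tscale :: "real \<Rightarrow> ('a \<Rightarrow>\<^sub>0 real) \<Rightarrow> ('a \<Rightarrow>\<^sub>0 real)" where
  "tscale c t = Poly_Mapping.map ((*) c) t"

definition teval :: "('a \<Rightarrow> real) \<Rightarrow> ('a \<Rightarrow>\<^sub>0 real) \<Rightarrow> real" where
  "teval B t = (\<Sum>p\<in>Poly_Mapping.keys t. Poly_Mapping.lookup t p * B p)"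

type_synonym 'g lie2 = "('g tvec \<times> 'g tvec) \<Rightarrow>\<^sub>0 real"

definition lie2_elems :: "('g, 'e::euclidean_space, 'm) lie_data_scheme \<Rightarrow> 'g lie2 set" where
  "lie2_elems G = {t. Poly_Mapping.keys t \<subseteq> lie_alg G \<times> lie_alg G}"

definition r_plus :: "'g lie2 \<Rightarrow> 'g lie2" where
  "r_plus r = tscale (1/2) (r + tmap prod.swap r)"

definition r_minus :: "'g lie2 \<Rightarrow> 'g lie2" where
  "r_minus r = tscale (1/2) (r - tmap prod.swap r)"

definition ad_tensor ::
  "('g, 'e::euclidean_space, 'm) lie_data_scheme \<Rightarrow> 'g tvec \<Rightarrow> 'g lie2 \<Rightarrow> 'g lie2" where
  "ad_tensor G v t = tmap (\<lambda>(x, y). (lie_bracket G v x, y)) t + tmap (\<lambda>(x, y). (x, lie_bracket G v y)) t"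

text \<open>A word \<open>[v\<^sub>1, \<dots>, v\<^sub>k]\<close> stands for the monomial \<open>v\<^sub>1 \<cdots> v\<^sub>k\<close> of the enveloping algebra \<open>U\<close>,
  and a list of \<open>n\<close> words for an elementary tensor in the \<open>n\<close>-fold tensor power of \<open>U\<close>.
  That power is the free vector space on such lists modulo the span \<open>U_null G n\<close> of the
  relations imposed, in any tensor factor, by linearity in each letter and by \<open>vw - wv = [v, w]\<close>.\<close>

type_synonym 'g utens = "'g tvec list list \<Rightarrow>\<^sub>0 real"

definition U_elems :: "('g, 'e::euclidean_space, 'm) lie_data_scheme \<Rightarrow> nat \<Rightarrow> 'g utens set" where
  "U_elems G n = {t. \<forall>p\<in>Poly_Mapping.keys t. length p = n \<and> (\<forall>u\<in>set p. set u \<subseteq> lie_alg G)}"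

inductive_set U_null :: "('g, 'e::euclidean_space, 'm) lie_data_scheme \<Rightarrow> nat \<Rightarrow> 'g utens set"
  for G :: "('g, 'e::euclidean_space, 'm) lie_data_scheme" and n :: nat where
  zero: "0 \<in> U_null G n"
| add: "s \<in> U_null G n \<Longrightarrow> t \<in> U_null G n \<Longrightarrow> s + t \<in> U_null G n"
| scale: "t \<in> U_null G n \<Longrightarrow> tscale c t \<in> U_null G n"
| linear: "v \<in> lie_alg G \<Longrightarrow> w \<in> lie_alg G \<Longrightarrow>
    \<forall>u\<in>set (P @ (p @ q) # Q). set u \<subseteq> lie_alg G \<Longrightarrow> length P + 1 + length Q = n \<Longrightarrow>
    Poly_Mapping.single (P @ (p @ (\<lambda>f. \<alpha> * v f + \<beta> * w f) # q) # Q) 1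
      - Poly_Mapping.single (P @ (p @ v # q) # Q) \<alpha>
      - Poly_Mapping.single (P @ (p @ w # q) # Q) \<beta> \<in> U_null G n"
| bracket: "v \<in> lie_alg G \<Longrightarrow> w \<in> lie_alg G \<Longrightarrow>
    \<forall>u\<in>set (P @ (p @ q) # Q). set u \<subseteq> lie_alg G \<Longrightarrow> length P + 1 + length Q = n \<Longrightarrow>
    Poly_Mapping.single (P @ (p @ v # w # q) # Q) 1
      - Poly_Mapping.single (P @ (p @ w # v # q) # Q) 1
      - Poly_Mapping.single (P @ (p @ lie_bracket G v w # q) # Q) 1 \<in> U_null G n"

definition U_eq :: "('g, 'e::euclidean_space, 'm) lie_data_scheme \<Rightarrow> nat \<Rightarrow> 'g utens \<Rightarrow> 'g utens \<Rightarrow> bool" where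
  "U_eq G n s t \<longleftrightarrow> s - t \<in> U_null G n"

definition U_mult :: "'g utens \<Rightarrow> 'g utens \<Rightarrow> 'g utens" where
  "U_mult s t = (\<Sum>p\<in>Poly_Mapping.keys s. \<Sum>q\<in>Poly_Mapping.keys t.
     Poly_Mapping.single (map2 (@) p q) (Poly_Mapping.lookup s p * Poly_Mapping.lookup t q))"

definition U_comm :: "'g utens \<Rightarrow> 'g utens \<Rightarrow> 'g utens" where
  "U_comm s t = U_mult s t - U_mult t s"

definition U_one2 :: "'g utens" where
  "U_one2 = Poly_Mapping.single [[], []] 1"

text \<open>For \<open>f\<close> in the tensor square of \<open>U\<close>, \<open>U_flip f\<close> is \<open>f\<^sub>2\<^sub>1\<close>.\<close>

definition U_flip :: "'g utens \<Rightarrow> 'g utens" where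
  "U_flip = tmap rev"

text \<open>The inclusions of the tensor square of the Lie algebra into the tensor square of \<open>U\<close> (injective
  by Poincare-Birkhoff-Witt), and into the factors \<open>i\<close>, \<open>j\<close> (counted from 0) of its tensor cube.\<close>

definition lie2_U :: "'g lie2 \<Rightarrow> 'g utens" where
  "lie2_U = tmap (\<lambda>(x, y). [[x], [y]])"

definition lie2_legs :: "nat \<Rightarrow> nat \<Rightarrow> 'g lie2 \<Rightarrow> 'g utens" where
  "lie2_legs i j = tmap (\<lambda>(x, y). (replicate 3 [])[i := [x], j := [y]])"

definition CYBE :: "('g, 'e::euclidean_space, 'm) lie_data_scheme \<Rightarrow> 'g lie2 \<Rightarrow> bool" where
  "CYBE G r \<longleftrightarrow> U_eq G 3
     (U_comm (lie2_legs 0 1 r) (lie2_legs 0 2 r) + U_comm (lie2_legs 0 1 r) (lie2_legs 1 2 r)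
      + U_comm (lie2_legs 0 2 r) (lie2_legs 1 2 r)) 0"

definition ad_invariant :: "('g, 'e::euclidean_space, 'm) lie_data_scheme \<Rightarrow> 'g lie2 \<Rightarrow> bool" where
  "ad_invariant G t \<longleftrightarrow> (\<forall>v\<in>lie_alg G. U_eq G 2 (lie2_U (ad_tensor G v t)) 0)"

text \<open>The pairing of \<open>U\<close> with functions: \<open>v\<^sub>1 \<cdots> v\<^sub>k\<close> is sent to the iterated derivative at the unit of
  \<open>(g\<^sub>1, \<dots>, g\<^sub>k) \<mapsto> a (g\<^sub>1 \<cdots> g\<^sub>k)\<close> along \<open>v\<^sub>1, \<dots>, v\<^sub>k\<close>.\<close>

fun U_pair :: "('g, 'm) monoid_scheme \<Rightarrow> 'g tvec list \<Rightarrow> ('g \<Rightarrow> real) \<Rightarrow> real" where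
  "U_pair G [] a = a \<one>\<^bsub>G\<^esub>"
| "U_pair G (v # p) a = v (\<lambda>g. U_pair G p (\<lambda>h. a (g \<otimes>\<^bsub>G\<^esub> h)))"

text \<open>A family \<open>F 0, F 1, \<dots>\<close> of tensors stands for the power series \<open>\<Sum>\<^sub>n \<hbar>\<^sup>n F n\<close>.\<close>

definition series_pair :: "('g, 'm) monoid_scheme \<Rightarrow> (nat \<Rightarrow> 'g utens) \<Rightarrow>
    ('g \<Rightarrow> real) \<Rightarrow> ('g \<Rightarrow> real) \<Rightarrow> real fps" where
  "series_pair G F a b = Abs_fps (\<lambda>n. teval (\<lambda>p. U_pair G (p ! 0) a * U_pair G (p ! 1) b) (F n))"


section \<open>Quasitriangular Poisson-Lie groups\<close>

definition poisson_bracket :: "('g, 'e::euclidean_space, 'm) lie_data_scheme \<Rightarrow>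
    (('g \<Rightarrow> real) \<Rightarrow> ('g \<Rightarrow> real) \<Rightarrow> 'g \<Rightarrow> real) \<Rightarrow> bool" where
  "poisson_bracket G P \<longleftrightarrow>
     (\<forall>a b. smooth_fun G a \<longrightarrow> smooth_fun G b \<longrightarrow> smooth_fun G (P a b) \<and> P b a = (\<lambda>g. - P a b g)) \<and>
     (\<forall>a b c \<alpha> \<beta>. smooth_fun G a \<longrightarrow> smooth_fun G b \<longrightarrow> smooth_fun G c \<longrightarrow>
        P (\<lambda>g. \<alpha> * a g + \<beta> * b g) c = (\<lambda>g. \<alpha> * P a c g + \<beta> * P b c g) \<and>
        P (\<lambda>g. a g * b g) c = (\<lambda>g. a g * P b c g + P a c g * b g) \<and>
        (\<forall>g. P a (P b c) g + P b (P c a) g + P c (P a b) g = 0))"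

text \<open>Multiplication is a Poisson map.\<close>

definition poisson_lie :: "('g, 'e::euclidean_space, 'm) lie_data_scheme \<Rightarrow>
    (('g \<Rightarrow> real) \<Rightarrow> ('g \<Rightarrow> real) \<Rightarrow> 'g \<Rightarrow> real) \<Rightarrow> bool" where
  "poisson_lie G P \<longleftrightarrow> poisson_bracket G P \<and>
     (\<forall>a b g h. smooth_fun G a \<longrightarrow> smooth_fun G b \<longrightarrow>
        P a b (g \<otimes>\<^bsub>G\<^esub> h) =
          P (\<lambda>k. a (g \<otimes>\<^bsub>G\<^esub> k)) (\<lambda>k. b (g \<otimes>\<^bsub>G\<^esub> k)) h +
          P (\<lambda>k. a (k \<otimes>\<^bsub>G\<^esub> h)) (\<lambda>k. b (k \<otimes>\<^bsub>G\<^esub> h)) g)"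

text \<open>The last condition says that the Lie cobracket, i.e. the linearisation of the Poisson structure
  at the unit, is \<open>\<delta> v = ad\<^sub>v r\<close>.\<close>

definition quasitriangular_poisson_lie :: "('g, 'e::euclidean_space, 'm) lie_data_scheme \<Rightarrow>
    (('g \<Rightarrow> real) \<Rightarrow> ('g \<Rightarrow> real) \<Rightarrow> 'g \<Rightarrow> real) \<Rightarrow> 'g lie2 \<Rightarrow> bool" where
  "quasitriangular_poisson_lie G P r \<longleftrightarrow>
     poisson_lie G P \<and> r \<in> lie2_elems G \<and> CYBE G r \<and> ad_invariant G (r_plus r) \<and>
     (\<forall>v\<in>lie_alg G. \<forall>a b. smooth_fun G a \<longrightarrow> smooth_fun G b \<longrightarrow>
        v (P a b) = teval (\<lambda>(x, y). x a * y b) (ad_tensor G v r))"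


section \<open>Hopf algebras of functions and classical 1-forms\<close>

text \<open>The tensor square of \<open>H\<close> is identified with its (injective) image in the functions of two
  variables, so a decomposition of \<open>(g, h) \<mapsto> a (gh)\<close> is a coproduct of \<open>a\<close>.\<close>

definition is_coproduct :: "('g, 'm) monoid_scheme \<Rightarrow> ('g \<Rightarrow> real) set \<Rightarrow> ('g \<Rightarrow> real) \<Rightarrow>
    (('g \<Rightarrow> real) \<times> ('g \<Rightarrow> real)) list \<Rightarrow> bool" where
  "is_coproduct G H a xs \<longleftrightarrow> set xs \<subseteq> H \<times> H \<and>
     (\<forall>g h. a (g \<otimes>\<^bsub>G\<^esub> h) = (\<Sum>(x, y)\<leftarrow>xs. x g * y h))"

definition function_hopf_algebra ::
  "('g, 'e::euclidean_space, 'm) lie_data_scheme \<Rightarrow> ('g \<Rightarrow> real) set \<Rightarrow> bool" where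
  "function_hopf_algebra G H \<longleftrightarrow>
     (\<forall>a\<in>H. smooth_fun G a) \<and> (\<lambda>g. 1) \<in> H \<and>
     (\<forall>a\<in>H. \<forall>b\<in>H. (\<lambda>g. a g * b g) \<in> H \<and> (\<forall>\<alpha> \<beta>. (\<lambda>g. \<alpha> * a g + \<beta> * b g) \<in> H)) \<and>
     (\<forall>a\<in>H. (\<exists>xs. is_coproduct G H a xs) \<and> (\<lambda>g. a (inv\<^bsub>G\<^esub> g)) \<in> H)"

definition coprod :: "('g, 'm) monoid_scheme \<Rightarrow> ('g \<Rightarrow> real) set \<Rightarrow> ('g \<Rightarrow> real) \<Rightarrow>
    (('g \<Rightarrow> real) \<times> ('g \<Rightarrow> real)) list" where
  "coprod G H a = (SOME xs. is_coproduct G H a xs)"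

definition coprod3 :: "('g, 'm) monoid_scheme \<Rightarrow> ('g \<Rightarrow> real) set \<Rightarrow> ('g \<Rightarrow> real) \<Rightarrow>
    (('g \<Rightarrow> real) \<times> ('g \<Rightarrow> real) \<times> ('g \<Rightarrow> real)) list" where
  "coprod3 G H a = concat (map (\<lambda>(x, u). map (\<lambda>(y, z). (x, y, z)) (coprod G H u)) (coprod G H a))"

text \<open>A 1-form assigns to a point \<open>g\<close> a functional of which only the values on \<^term>\<open>tangent G g\<close>
  matter; equality of forms is \<open>form_eq\<close>.\<close>

type_synonym 'g form = "'g \<Rightarrow> 'g tvec \<Rightarrow> real"

definition form_eq :: "('g, 'e::euclidean_space, 'm) lie_data_scheme \<Rightarrow> 'g form \<Rightarrow> 'g form \<Rightarrow> bool" where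
  "form_eq G \<sigma> \<tau> \<longleftrightarrow> (\<forall>g. \<forall>x\<in>tangent G g. \<sigma> g x = \<tau> g x)"

definition dform :: "('g \<Rightarrow> real) \<Rightarrow> 'g form" where
  "dform a = (\<lambda>g x. x a)"

definition forms :: "('g \<Rightarrow> real) set \<Rightarrow> 'g form set" where
  "forms H = {\<tau>. \<exists>xs. set xs \<subseteq> H \<times> H \<and> \<tau> = (\<lambda>g x. \<Sum>(a, b)\<leftarrow>xs. a g * dform b g x)}"

definition coact_left :: "('g, 'e::euclidean_space, 'm) lie_data_scheme \<Rightarrow> ('g \<Rightarrow> real) set \<Rightarrow>
    'g form \<Rightarrow> (('g \<Rightarrow> real) \<times> 'g form) list" where
  "coact_left G H \<tau> = (SOME xs. set xs \<subseteq> H \<times> forms H \<and>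
     (\<forall>g h. \<forall>x\<in>tangent G h. \<tau> (g \<otimes>\<^bsub>G\<^esub> h) (lpush G g x) = (\<Sum>(a, \<sigma>)\<leftarrow>xs. a g * \<sigma> h x)))"

definition coact_right :: "('g, 'e::euclidean_space, 'm) lie_data_scheme \<Rightarrow> ('g \<Rightarrow> real) set \<Rightarrow>
    'g form \<Rightarrow> ('g form \<times> ('g \<Rightarrow> real)) list" where
  "coact_right G H \<tau> = (SOME xs. set xs \<subseteq> forms H \<times> H \<and>
     (\<forall>g h. \<forall>x\<in>tangent G g. \<tau> (g \<otimes>\<^bsub>G\<^esub> h) (rpush G h x) = (\<Sum>(\<sigma>, a)\<leftarrow>xs. \<sigma> g x * a h)))"

text \<open>\<open>(id \<otimes> \<Delta>\<^sub>R) \<Delta>\<^sub>L \<tau>\<close>\<close>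

definition coact3 :: "('g, 'e::euclidean_space, 'm) lie_data_scheme \<Rightarrow> ('g \<Rightarrow> real) set \<Rightarrow>
    'g form \<Rightarrow> (('g \<Rightarrow> real) \<times> 'g form \<times> ('g \<Rightarrow> real)) list" where
  "coact3 G H \<tau> = concat (map (\<lambda>(a, \<sigma>). map (\<lambda>(\<rho>, b). (a, \<rho>, b)) (coact_right G H \<sigma>)) (coact_left G H \<tau>))"


section \<open>Twisting\<close>

text \<open>The formal parameter \<open>\<hbar>\<close> is \<^term>\<open>fps_X :: real fps\<close>; an element of \<open>H[[\<hbar>]]\<close> is a function
  with values in \<^typ>\<open>real fps\<close> all of whose coefficient functions lie in \<open>H\<close>.\<close>

type_synonym 'g cochain2 = "('g \<Rightarrow> real) \<Rightarrow> ('g \<Rightarrow> real) \<Rightarrow> real fps"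

definition bilinear_cochain :: "('g \<Rightarrow> real) set \<Rightarrow> 'g cochain2 \<Rightarrow> bool" where
  "bilinear_cochain H B \<longleftrightarrow> (\<forall>a\<in>H. \<forall>b\<in>H. \<forall>c\<in>H. \<forall>\<alpha> \<beta>.
     B (\<lambda>g. \<alpha> * a g + \<beta> * b g) c = fps_const \<alpha> * B a c + fps_const \<beta> * B b c \<and>
     B c (\<lambda>g. \<alpha> * a g + \<beta> * b g) = fps_const \<alpha> * B c a + fps_const \<beta> * B c b)"

definition convolution :: "('g, 'm) monoid_scheme \<Rightarrow> ('g \<Rightarrow> real) set \<Rightarrow>
    'g cochain2 \<Rightarrow> 'g cochain2 \<Rightarrow> 'g cochain2" where
  "convolution G H A B a b =
     (\<Sum>(a1, a2)\<leftarrow>coprod G H a. \<Sum>(b1, b2)\<leftarrow>coprod G H b. A a1 b1 * B a2 b2)"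

definition convolution_inverse :: "('g, 'm) monoid_scheme \<Rightarrow> ('g \<Rightarrow> real) set \<Rightarrow>
    'g cochain2 \<Rightarrow> 'g cochain2 \<Rightarrow> bool" where
  "convolution_inverse G H A B \<longleftrightarrow> bilinear_cochain H A \<and> bilinear_cochain H B \<and>
     (\<forall>a\<in>H. \<forall>b\<in>H. convolution G H A B a b = fps_const (a \<one>\<^bsub>G\<^esub> * b \<one>\<^bsub>G\<^esub>) \<and>
                   convolution G H B A a b = fps_const (a \<one>\<^bsub>G\<^esub> * b \<one>\<^bsub>G\<^esub>))"

text \<open>In the following three definitions \<open>F'\<close> is the convolution inverse of \<open>F\<close>.\<close>

definition twist_mult :: "('g, 'm) monoid_scheme \<Rightarrow> ('g \<Rightarrow> real) set \<Rightarrow> 'g cochain2 \<Rightarrow> 'g cochain2 \<Rightarrow>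
    ('g \<Rightarrow> real) \<Rightarrow> ('g \<Rightarrow> real) \<Rightarrow> 'g \<Rightarrow> real fps" where
  "twist_mult G H F F' a b = (\<lambda>g.
     \<Sum>(a1, a2, a3)\<leftarrow>coprod3 G H a. \<Sum>(b1, b2, b3)\<leftarrow>coprod3 G H b.
       F a1 b1 * fps_const (a2 g * b2 g) * F' a3 b3)"

definition twist_left :: "('g, 'e::euclidean_space, 'm) lie_data_scheme \<Rightarrow> ('g \<Rightarrow> real) set \<Rightarrow>
    'g cochain2 \<Rightarrow> 'g cochain2 \<Rightarrow> ('g \<Rightarrow> real) \<Rightarrow> 'g form \<Rightarrow> 'g \<Rightarrow> 'g tvec \<Rightarrow> real fps" where
  "twist_left G H F F' a \<tau> = (\<lambda>g x.
     \<Sum>(a1, a2, a3)\<leftarrow>coprod3 G H a. \<Sum>(t1, t2, t3)\<leftarrow>coact3 G H \<tau>.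
       F a1 t1 * fps_const (a2 g * t2 g x) * F' a3 t3)"

definition twist_right :: "('g, 'e::euclidean_space, 'm) lie_data_scheme \<Rightarrow> ('g \<Rightarrow> real) set \<Rightarrow>
    'g cochain2 \<Rightarrow> 'g cochain2 \<Rightarrow> 'g form \<Rightarrow> ('g \<Rightarrow> real) \<Rightarrow> 'g \<Rightarrow> 'g tvec \<Rightarrow> real fps" where
  "twist_right G H F F' \<tau> a = (\<lambda>g x.
     \<Sum>(t1, t2, t3)\<leftarrow>coact3 G H \<tau>. \<Sum>(a1, a2, a3)\<leftarrow>coprod3 G H a.
       F t1 a1 * fps_const (t2 g x * a2 g) * F' t3 a3)"

text \<open>The \<open>\<hbar>\<close>-linear extension to \<open>H[[\<hbar>]]\<close> of a map defined on \<open>H\<close>.\<close>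

definition hbar_lift :: "(('g \<Rightarrow> real) \<Rightarrow> real fps) \<Rightarrow> ('g \<Rightarrow> real fps) \<Rightarrow> real fps" where
  "hbar_lift \<phi> A = Abs_fps (\<lambda>n. \<Sum>i\<le>n. fps_nth (\<phi> (\<lambda>g. fps_nth (A g) i)) (n - i))"

text \<open>\<open>m\<close> is the product, restricted to \<open>H\<close>, of an \<open>\<hbar>\<close>-linear Hopf algebra structure on \<open>H[[\<hbar>]]\<close>
  with the undeformed unit, coproduct and counit.\<close>

definition deformed_hopf_algebra :: "('g, 'm) monoid_scheme \<Rightarrow> ('g \<Rightarrow> real) set \<Rightarrow>
    (('g \<Rightarrow> real) \<Rightarrow> ('g \<Rightarrow> real) \<Rightarrow> 'g \<Rightarrow> real fps) \<Rightarrow> bool" where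
  "deformed_hopf_algebra G H m \<longleftrightarrow>
     (\<forall>a\<in>H. \<forall>b\<in>H. \<forall>c\<in>H. \<forall>g. hbar_lift (\<lambda>u. m u c g) (m a b) = hbar_lift (\<lambda>u. m a u g) (m b c)) \<and>
     (\<forall>a\<in>H. \<forall>g. m (\<lambda>_. 1) a g = fps_const (a g) \<and> m a (\<lambda>_. 1) g = fps_const (a g)) \<and>
     (\<forall>a\<in>H. \<forall>b\<in>H. \<forall>g h. m a b (g \<otimes>\<^bsub>G\<^esub> h) =
        (\<Sum>(a1, a2)\<leftarrow>coprod G H a. \<Sum>(b1, b2)\<leftarrow>coprod G H b. m a1 b1 g * m a2 b2 h)) \<and>
     (\<forall>a\<in>H. \<forall>b\<in>H. m a b \<one>\<^bsub>G\<^esub> = fps_const (a \<one>\<^bsub>G\<^esub> * b \<one>\<^bsub>G\<^esub>)) \<and>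
     (\<exists>S. (\<forall>a\<in>H. \<forall>n. (\<lambda>g. fps_nth (S a g) n) \<in> H) \<and>
        (\<forall>a\<in>H. \<forall>b\<in>H. \<forall>\<alpha> \<beta> g. S (\<lambda>h. \<alpha> * a h + \<beta> * b h) g =
           fps_const \<alpha> * S a g + fps_const \<beta> * S b g) \<and>
        (\<forall>a\<in>H. \<forall>g.
           (\<Sum>(a1, a2)\<leftarrow>coprod G H a. hbar_lift (\<lambda>u. m u a2 g) (S a1)) = fps_const (a \<one>\<^bsub>G\<^esub>) \<and>
           (\<Sum>(a1, a2)\<leftarrow>coprod G H a. hbar_lift (\<lambda>u. m a1 u g) (S a2)) = fps_const (a \<one>\<^bsub>G\<^esub>)))"

definition coquasitriangular :: "('g, 'm) monoid_scheme \<Rightarrow> ('g \<Rightarrow> real) set \<Rightarrow>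
    (('g \<Rightarrow> real) \<Rightarrow> ('g \<Rightarrow> real) \<Rightarrow> 'g \<Rightarrow> real fps) \<Rightarrow> 'g cochain2 \<Rightarrow> bool" where
  "coquasitriangular G H m R \<longleftrightarrow>
     deformed_hopf_algebra G H m \<and> (\<exists>R'. convolution_inverse G H R R') \<and>
     (\<forall>a\<in>H. \<forall>b\<in>H. \<forall>c\<in>H.
        hbar_lift (\<lambda>u. R u c) (m a b) = (\<Sum>(c1, c2)\<leftarrow>coprod G H c. R a c1 * R b c2) \<and>
        hbar_lift (\<lambda>u. R a u) (m b c) = (\<Sum>(a1, a2)\<leftarrow>coprod G H a. R a1 c * R a2 b)) \<and>
     (\<forall>a\<in>H. \<forall>b\<in>H. \<forall>g.
        (\<Sum>(a1, a2)\<leftarrow>coprod G H a. \<Sum>(b1, b2)\<leftarrow>coprod G H b. m b1 a1 g * R a2 b2) =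
        (\<Sum>(a1, a2)\<leftarrow>coprod G H a. \<Sum>(b1, b2)\<leftarrow>coprod G H b. R a1 b1 * m a2 b2 g))"

text \<open>\<open>s = O(\<hbar>\<^sup>2)\<close>\<close>

definition O_hbar2 :: "real fps \<Rightarrow> bool" where
  "O_hbar2 s \<longleftrightarrow> fps_X ^ 2 dvd s"

text \<open>\<open>m\<close> and \<open>R\<close> have the Poisson bracket \<open>P\<close> and the tensor \<open>r\<close> as their semiclassical limits.\<close>

definition quantises :: "('g \<Rightarrow> real) set \<Rightarrow> (('g \<Rightarrow> real) \<Rightarrow> ('g \<Rightarrow> real) \<Rightarrow> 'g \<Rightarrow> real) \<Rightarrow>
    (('g \<Rightarrow> real) \<Rightarrow> ('g \<Rightarrow> real) \<Rightarrow> 'g \<Rightarrow> real fps) \<Rightarrow> bool" where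
  "quantises H P m \<longleftrightarrow> (\<forall>a\<in>H. \<forall>b\<in>H. \<forall>g.
     O_hbar2 (m a b g - m b a g - fps_X * fps_const (P a b g)))"

definition quantises_r :: "('g, 'm) monoid_scheme \<Rightarrow> ('g \<Rightarrow> real) set \<Rightarrow> 'g lie2 \<Rightarrow> 'g cochain2 \<Rightarrow> bool" where
  "quantises_r G H r R \<longleftrightarrow> (\<forall>a\<in>H. \<forall>b\<in>H. O_hbar2 (R a b - fps_const (a \<one>\<^bsub>G\<^esub> * b \<one>\<^bsub>G\<^esub>)
     - fps_X * fps_const (teval (\<lambda>(x, y). x a * y b) r)))"

text \<open>The preconnection obtained by semiclassicalising a deformed bimodule: the coefficient of \<open>\<hbar>\<close> in
  \<open>a \<bullet> \<tau> - \<tau> \<bullet> a\<close>.\<close>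

definition semiclassical :: "(('g \<Rightarrow> real) \<Rightarrow> 'g form \<Rightarrow> 'g \<Rightarrow> 'g tvec \<Rightarrow> real fps) \<Rightarrow>
    ('g form \<Rightarrow> ('g \<Rightarrow> real) \<Rightarrow> 'g \<Rightarrow> 'g tvec \<Rightarrow> real fps) \<Rightarrow> ('g \<Rightarrow> real) \<Rightarrow> 'g form \<Rightarrow> 'g form" where
  "semiclassical ml mr a \<tau> = (\<lambda>g x. fps_nth (ml a \<tau> g x - mr \<tau> a g x) 1)"


section \<open>Preconnections\<close>

definition preconnection :: "('g, 'e::euclidean_space, 'm) lie_data_scheme \<Rightarrow> ('g \<Rightarrow> real) set \<Rightarrow>
    (('g \<Rightarrow> real) \<Rightarrow> ('g \<Rightarrow> real) \<Rightarrow> 'g \<Rightarrow> real) \<Rightarrow> (('g \<Rightarrow> real) \<Rightarrow> 'g form \<Rightarrow> 'g form) \<Rightarrow> bool" where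
  "preconnection G H P \<gamma> \<longleftrightarrow>
     (\<forall>a\<in>H. \<forall>\<tau>\<in>forms H. \<gamma> a \<tau> \<in> forms H) \<and>
     (\<forall>a\<in>H. \<forall>b\<in>H. \<forall>\<sigma>\<in>forms H. \<forall>\<tau>\<in>forms H. \<forall>\<alpha> \<beta>.
        form_eq G (\<gamma> (\<lambda>g. \<alpha> * a g + \<beta> * b g) \<tau>) (\<lambda>g x. \<alpha> * \<gamma> a \<tau> g x + \<beta> * \<gamma> b \<tau> g x) \<and>
        form_eq G (\<gamma> a (\<lambda>g x. \<alpha> * \<sigma> g x + \<beta> * \<tau> g x)) (\<lambda>g x. \<alpha> * \<gamma> a \<sigma> g x + \<beta> * \<gamma> a \<tau> g x)) \<and>
     (\<forall>a\<in>H. \<forall>b\<in>H. \<forall>\<tau>\<in>forms H.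
        form_eq G (\<gamma> (\<lambda>g. a g * b g) \<tau>) (\<lambda>g x. a g * \<gamma> b \<tau> g x + \<gamma> a \<tau> g x * b g) \<and>
        form_eq G (\<gamma> a (\<lambda>g x. b g * \<tau> g x)) (\<lambda>g x. b g * \<gamma> a \<tau> g x + P a b g * \<tau> g x)) \<and>
     (\<forall>a\<in>H. \<forall>b\<in>H.
        form_eq G (dform (P a b)) (\<lambda>g x. \<gamma> a (dform b) g x - \<gamma> b (dform a) g x))"

definition left_triv :: "('g, 'm) monoid_scheme \<Rightarrow> 'g form \<Rightarrow> 'g \<Rightarrow> 'g tvec \<Rightarrow> real" where
  "left_triv G \<tau> g v = \<tau> g (lpush G g v)"

definition lhat :: "('g, 'm) monoid_scheme \<Rightarrow> ('g \<Rightarrow> real) \<Rightarrow> 'g \<Rightarrow> 'g tvec \<Rightarrow> real" where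
  "lhat G a g v = lpush G g v a"

definition ad_star :: "('g, 'e::euclidean_space, 'm) lie_data_scheme \<Rightarrow> 'g tvec \<Rightarrow>
    ('g tvec \<Rightarrow> real) \<Rightarrow> 'g tvec \<Rightarrow> real" where
  "ad_star G v \<psi> w = \<psi> (lie_bracket G w v)"

definition xi_hat :: "('g, 'e::euclidean_space, 'm) lie_data_scheme \<Rightarrow> 'g lie2 \<Rightarrow>
    (('g tvec \<Rightarrow> real) \<Rightarrow> ('g tvec \<Rightarrow> real) \<Rightarrow> 'g tvec \<Rightarrow> real) \<Rightarrow>
    ('g tvec \<Rightarrow> real) \<Rightarrow> ('g tvec \<Rightarrow> real) \<Rightarrow> 'g tvec \<Rightarrow> real" where
  "xi_hat G r \<Xi> \<phi> \<psi> w = \<Xi> \<phi> \<psi> w - teval (\<lambda>(x, y). \<phi> x * ad_star G y \<psi> w) (r_minus r)"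

text \<open>The bracket \<open>{a, s}\<close> of a function with a function \<open>s\<close> valued in the dual of the Lie algebra is taken
  componentwise.\<close>

definition has_xi :: "('g, 'e::euclidean_space, 'm) lie_data_scheme \<Rightarrow> ('g \<Rightarrow> real) set \<Rightarrow>
    (('g \<Rightarrow> real) \<Rightarrow> ('g \<Rightarrow> real) \<Rightarrow> 'g \<Rightarrow> real) \<Rightarrow> (('g \<Rightarrow> real) \<Rightarrow> 'g form \<Rightarrow> 'g form) \<Rightarrow>
    (('g tvec \<Rightarrow> real) \<Rightarrow> ('g tvec \<Rightarrow> real) \<Rightarrow> 'g tvec \<Rightarrow> real) \<Rightarrow> bool" where
  "has_xi G H P \<gamma> \<Xi> \<longleftrightarrow> (\<forall>a\<in>H. \<forall>\<tau>\<in>forms H. \<forall>g. \<forall>v\<in>lie_alg G.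
     left_triv G (\<gamma> a \<tau>) g v =
       P a (\<lambda>h. left_triv G \<tau> h v) g + \<Xi> (lhat G a g) (left_triv G \<tau> g) v)"

text \<open>Bilinearity of \<open>\<Xi>\<close> need not be demanded: \<open>xi_hat = 0\<close> determines it on the dual of the Lie
  algebra.\<close>

definition canonical_preconnection :: "('g, 'e::euclidean_space, 'm) lie_data_scheme \<Rightarrow>
    ('g \<Rightarrow> real) set \<Rightarrow> (('g \<Rightarrow> real) \<Rightarrow> ('g \<Rightarrow> real) \<Rightarrow> 'g \<Rightarrow> real) \<Rightarrow> 'g lie2 \<Rightarrow>
    (('g \<Rightarrow> real) \<Rightarrow> 'g form \<Rightarrow> 'g form) \<Rightarrow> bool" where
  "canonical_preconnection G H P r \<gamma> \<longleftrightarrow> preconnection G H P \<gamma> \<and>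
     (\<exists>\<Xi>. has_xi G H P \<gamma> \<Xi> \<and>
        (\<forall>\<phi>\<in>lie_dual G. \<forall>\<psi>\<in>lie_dual G. \<forall>w\<in>lie_alg G. xi_hat G r \<Xi> \<phi> \<psi> w = 0))"


section \<open>Actions of the group and of its Lie algebra\<close>

definition act_fun :: "('g, 'm) monoid_scheme \<Rightarrow> 'g \<Rightarrow> ('g \<Rightarrow> real) \<Rightarrow> 'g \<Rightarrow> real" where
  "act_fun G g a = (\<lambda>h. a (inv\<^bsub>G\<^esub> g \<otimes>\<^bsub>G\<^esub> h))"

definition act_form :: "('g, 'm) monoid_scheme \<Rightarrow> 'g \<Rightarrow> 'g form \<Rightarrow> 'g form" where
  "act_form G g \<tau> = (\<lambda>h x. \<tau> (inv\<^bsub>G\<^esub> g \<otimes>\<^bsub>G\<^esub> h) (lpush G (inv\<^bsub>G\<^esub> g) x))"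

definition fun_act :: "('g, 'm) monoid_scheme \<Rightarrow> ('g \<Rightarrow> real) \<Rightarrow> 'g \<Rightarrow> 'g \<Rightarrow> real" where
  "fun_act G a g = (\<lambda>h. a (h \<otimes>\<^bsub>G\<^esub> inv\<^bsub>G\<^esub> g))"

definition form_act :: "('g, 'm) monoid_scheme \<Rightarrow> 'g form \<Rightarrow> 'g \<Rightarrow> 'g form" where
  "form_act G \<tau> g = (\<lambda>h x. \<tau> (h \<otimes>\<^bsub>G\<^esub> inv\<^bsub>G\<^esub> g) (rpush G (inv\<^bsub>G\<^esub> g) x))"

text \<open>The infinitesimal actions are the derivatives along \<open>v\<close> at the unit of the maps
  \<open>g \<mapsto> g \<rhd> a\<close>, etc., taken pointwise.\<close>

definition lie_act_fun :: "('g, 'm) monoid_scheme \<Rightarrow> 'g tvec \<Rightarrow> ('g \<Rightarrow> real) \<Rightarrow> 'g \<Rightarrow> real" where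
  "lie_act_fun G v a = (\<lambda>h. v (\<lambda>g. act_fun G g a h))"

definition lie_act_form :: "('g, 'm) monoid_scheme \<Rightarrow> 'g tvec \<Rightarrow> 'g form \<Rightarrow> 'g form" where
  "lie_act_form G v \<tau> = (\<lambda>h x. v (\<lambda>g. act_form G g \<tau> h x))"

definition fun_lie_act :: "('g, 'm) monoid_scheme \<Rightarrow> ('g \<Rightarrow> real) \<Rightarrow> 'g tvec \<Rightarrow> 'g \<Rightarrow> real" where
  "fun_lie_act G a v = (\<lambda>h. v (\<lambda>g. fun_act G a g h))"

definition form_lie_act :: "('g, 'm) monoid_scheme \<Rightarrow> 'g form \<Rightarrow> 'g tvec \<Rightarrow> 'g form" where
  "form_lie_act G \<tau> v = (\<lambda>h x. v (\<lambda>g. form_act G \<tau> g h x))"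

definition gamma_r :: "('g, 'm) monoid_scheme \<Rightarrow> 'g lie2 \<Rightarrow> ('g \<Rightarrow> real) \<Rightarrow> 'g form \<Rightarrow> 'g form" where
  "gamma_r G r a \<tau> = (\<lambda>h x. teval (\<lambda>(v, w).
     fun_lie_act G a v h * form_lie_act G \<tau> w h x - lie_act_fun G v a h * lie_act_form G w \<tau> h x)
     (r_minus r))"

end

theory Submission
  imports Defs
begin

text \<open>
The cochain is \<open>F = \<epsilon> \<otimes> \<epsilon> + \<hbar> \<phi> + O(\<hbar>\<^sup>2)\<close>, where \<open>\<phi>\<close> is the pairing with \<open>f\<close>, so its convolution
inverse is \<open>\<epsilon> \<otimes> \<epsilon> - \<hbar> \<phi> + O(\<hbar>\<^sup>2)\<close>. To first order only one of the two cochains around a twisted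
product differs from \<open>\<epsilon> \<otimes> \<epsilon>\<close>, and the counits collapse the remaining coproducts and coactions:
the coefficient of \<open>\<hbar>\<close> in \<open>a \<bullet> \<tau>\<close> at \<open>g\<close> is
\<open>\<phi>(a(- g), \<tau>(- g)) - \<phi>(a(g -), \<tau>(g -))\<close>, where \<open>\<tau>(- g)\<close> and \<open>\<tau>(g -)\<close> are the translates of the form,
paired with a fixed vector at \<open>g\<close> (\<open>twisted_sum\<close>, \<open>twist_left_nth\<close>). In \<open>\<tau> \<bullet> a\<close> the arguments of
\<open>\<phi>\<close> are exchanged. The commutator therefore sees only \<open>\<phi>\<^sub>2\<^sub>1 - \<phi>\<close>, which is the pairing with
\<open>r\<^sub>- = f\<^sub>2\<^sub>1 - f\<close>, and becomes
\<open>\<gamma>(a, \<tau>)(g) = r\<^sub>-(a(g -), \<tau>(g -)) - r\<^sub>-(a(- g), \<tau>(- g))\<close>.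
Each \<open>r\<^sub>-(\<dots>)\<close> pairs a product of two derivatives at the unit. The actions of the
Lie algebra differ from these derivatives by a sign, caused by the inverse in the definition of the
action, and two signs cancel; this is the displayed formula for \<open>\<gamma>\<close> (\<open>gamma_r_eq\<close>). The same
computation for two functions expresses the Poisson bracket through \<open>r\<^sub>-\<close>.

Since \<open>v\<close> and \<open>w\<close> act by derivations that commute with \<open>d\<close>, and \<open>r\<^sub>-\<close> is antisymmetric,
the axioms of a preconnection can be read off. To find \<open>\<Xi>\<close>, a form is evaluated on the left invariant
vector field of \<open>z\<close>. This field is preserved by left translations. Moving it along right translations
produces the bracket \<open>[z, w]\<close> (\<open>rder_form_lpush\<close>), which is exactly the coadjoint term that
\<open>xi_hat = 0\<close> prescribes.

Two points need care. Elements of the enveloping algebra are given by representatives modulo relations, and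
these relations must pair to zero with functions in \<open>H\<close> (\<open>pair2_U_null\<close>). The coaction formulas hold only
on tangent vectors, so translations have to preserve tangent vectors; as these are normalised to
vanish on functions that are not smooth, this amounts to showing that translations preserve
smoothness (\<open>smooth_fun_left_translate\<close>, \<open>smooth_fun_right_translate\<close>).
\<close>

section \<open>Translations preserve smooth functions\<close>

lemma Ck_on_subset: "Ck_on n S f \<Longrightarrow> T \<subseteq> S \<Longrightarrow> Ck_on n T f"
  by (induction n arbitrary: f) (auto intro: continuous_on_subset)

lemma frechet_derivative_cong_open:
  assumes "open S" "x \<in> S" "\<And>x. x \<in> S \<Longrightarrow> f x = g x" "f differentiable (at x)"
  shows "g differentiable (at x) \<and> frechet_derivative g (at x) = frechet_derivative f (at x)"
proof -
  have "(f has_derivative frechet_derivative f (at x)) (at x)"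
    using assms(4) frechet_derivative_works by blast
  then have "(g has_derivative frechet_derivative f (at x)) (at x)"
    by (rule has_derivative_transform_within_open[OF _ assms(1,2)]) (use assms(3) in auto)
  then show ?thesis
    using frechet_derivative_at differentiable_def by metis
qed

lemma Ck_on_cong_open:
  assumes "open S" "Ck_on n S f" "\<And>x. x \<in> S \<Longrightarrow> f x = g x"
  shows "Ck_on n S g"
  using assms(2,3)
proof (induction n arbitrary: f g)
  case 0
  then show ?case using continuous_on_eq by (simp only: Ck_on.simps) blast
next
  case (Suc n)
  have *: "g differentiable (at x) \<and> frechet_derivative g (at x) = frechet_derivative f (at x)"
    if "x \<in> S" for x
    using frechet_derivative_cong_open[OF assms(1) that] Suc.prems that by auto
  have "Ck_on n S (\<lambda>x. frechet_derivative g (at x) v)" for v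
    by (rule Suc.IH[of "\<lambda>x. frechet_derivative f (at x) v"]) (use Suc.prems * in auto)
  then show ?case using * by auto
qed

text \<open>A function need only be \<open>C\<^sup>k\<close> near each point because the derivatives in the definition are full
  ones, which depend only on the germ of the function.\<close>

lemma Ck_on_local:
  assumes "\<And>x. x \<in> S \<Longrightarrow> \<exists>T. open T \<and> x \<in> T \<and> Ck_on n T f"
  shows "Ck_on n S f"
  using assms
proof (induction n arbitrary: f)
  case 0
  have "isCont f x" if x: "x \<in> S" for x
  proof -
    obtain T where "open T" "x \<in> T" "continuous_on T f" using 0[OF x] by auto
    then show ?thesis by (simp add: continuous_on_eq_continuous_at)
  qed
  then show ?case by (simp add: continuous_at_imp_continuous_on)
next
  case (Suc n)
  have "\<exists>T. open T \<and> x \<in> T \<and> Ck_on n T (\<lambda>x. frechet_derivative f (at x) v)" if x: "x \<in> S" for x v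
    using Suc.prems[OF x] by (auto simp only: Ck_on.simps)
  then have "Ck_on n S (\<lambda>x. frechet_derivative f (at x) v)" for v
    by (rule Suc.IH)
  moreover have "f differentiable (at x)" if x: "x \<in> S" for x
    using Suc.prems[OF x] by (auto simp only: Ck_on.simps)
  ultimately show ?case by simp
qed

lemma Ck_on_SucD: "Ck_on (Suc n) S f \<Longrightarrow> Ck_on n S f"
proof (induction n arbitrary: f)
  case 0
  then show ?case
    by (auto intro!: differentiable_imp_continuous_on simp: differentiable_on_def
        differentiable_at_withinI)
next
  case (Suc n)
  then show ?case by (metis Ck_on.simps(2))
qed

lemma Ck_on_const: "Ck_on n S (\<lambda>_. c)"
  by (induction n arbitrary: c) (auto simp: frechet_derivative_const)

lemma Ck_on_bounded_linear: "bounded_linear L \<Longrightarrow> Ck_on n S L"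
proof (induction n)
  case 0
  then show ?case by (simp add: linear_continuous_on)
next
  case (Suc n)
  then have "frechet_derivative L (at x) = L" for x
    by (metis bounded_linear_imp_has_derivative frechet_derivative_at)
  then show ?case using Suc
    by (auto simp: Ck_on_const bounded_linear_imp_differentiable)
qed

lemma Ck_on_add:
  assumes "open S" "Ck_on n S f" "Ck_on n S g"
  shows "Ck_on n S (\<lambda>x. f x + g x)"
  using assms(2,3)
proof (induction n arbitrary: f g)
  case 0
  then show ?case by (auto intro: continuous_on_add)
next
  case (Suc n)
  have *: "((\<lambda>x. f x + g x) has_derivative
      (\<lambda>v. frechet_derivative f (at x) v + frechet_derivative g (at x) v)) (at x)"
    if "x \<in> S" for x
    using Suc.prems that by (auto simp: frechet_derivative_works intro!: has_derivative_add)
  have "Ck_on n S (\<lambda>x. frechet_derivative (\<lambda>x. f x + g x) (at x) v)" for v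
  proof (rule Ck_on_cong_open[OF assms(1)])
    show "Ck_on n S (\<lambda>x. frechet_derivative f (at x) v + frechet_derivative g (at x) v)"
      using Suc.prems by (intro Suc.IH) auto
  qed (simp add: frechet_derivative_at[OF *, symmetric])
  then show ?case using * by (auto simp: differentiable_def)
qed

lemma Ck_on_sum:
  assumes "open S" "\<And>i. i \<in> I \<Longrightarrow> Ck_on n S (f i)"
  shows "Ck_on n S (\<lambda>x. \<Sum>i\<in>I. f i x)"
  using assms(2) by (induction I rule: infinite_finite_induct)
    (auto simp: Ck_on_const intro: Ck_on_add[OF assms(1)])

lemma Ck_on_scaleR:
  fixes f :: "'a::real_normed_vector \<Rightarrow> real" and g :: "'a \<Rightarrow> 'b::real_normed_vector"
  assumes "open S" "Ck_on n S f" "Ck_on n S g"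
  shows "Ck_on n S (\<lambda>x. f x *\<^sub>R g x)"
  using assms(2,3)
proof (induction n arbitrary: f g)
  case 0
  then show ?case by (auto intro: continuous_on_scaleR)
next
  case (Suc n)
  have d: "f differentiable at x" "g differentiable at x" if "x \<in> S" for x
    using Suc.prems that by auto
  have *: "((\<lambda>x. f x *\<^sub>R g x) has_derivative
      (\<lambda>v. f x *\<^sub>R frechet_derivative g (at x) v + frechet_derivative f (at x) v *\<^sub>R g x)) (at x)"
    if "x \<in> S" for x
    using has_derivative_scaleR[OF d[OF that, unfolded frechet_derivative_works]] .
  have "Ck_on n S (\<lambda>x. frechet_derivative (\<lambda>x. f x *\<^sub>R g x) (at x) v)" for v
  proof (rule Ck_on_cong_open[OF assms(1)])
    show "Ck_on n S (\<lambda>x. f x *\<^sub>R frechet_derivative g (at x) v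
        + frechet_derivative f (at x) v *\<^sub>R g x)"
      using Suc.prems Ck_on_SucD[OF Suc.prems(1)] Ck_on_SucD[OF Suc.prems(2)]
      by (intro Ck_on_add[OF assms(1)] Suc.IH) auto
  qed (simp add: frechet_derivative_at[OF *, symmetric])
  then show ?case using * by (auto simp: differentiable_def)
qed

text \<open>The chain rule writes the derivative of the composite as \<open>\<Sum>\<^sub>i (D\<^sub>v f \<bullet> i) (D\<^sub>i g) \<circ> f\<close>, a sum over
  a basis whose summands are products of \<open>C\<^sup>n\<close> functions by induction. The basis turns the derivative of
  \<open>g\<close> in a varying direction into derivatives in fixed directions, which is all that the
  definition of \<^const>\<open>Ck_on\<close> speaks of.\<close>

lemma Ck_on_compose:
  fixes f :: "'a::real_normed_vector \<Rightarrow> 'b::euclidean_space" and g :: "'b \<Rightarrow> 'c::real_normed_vector"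
  assumes "open S" "f ` S \<subseteq> T" "Ck_on n S f" "Ck_on n T g"
  shows "Ck_on n S (\<lambda>x. g (f x))"
  using assms(3,4)
proof (induction n arbitrary: g)
  case 0
  then show ?case using assms(2) by (auto intro: continuous_on_compose2)
next
  case (Suc n)
  have df: "(f has_derivative frechet_derivative f (at x)) (at x)"
    and dg: "(g has_derivative frechet_derivative g (at (f x))) (at (f x))" if "x \<in> S" for x
    using Suc.prems that assms(2) by (auto simp: frechet_derivative_works[symmetric])
  have *: "((\<lambda>x. g (f x)) has_derivative
      (\<lambda>v. frechet_derivative g (at (f x)) (frechet_derivative f (at x) v))) (at x)"
    if "x \<in> S" for x
    using diff_chain_at[OF df[OF that] dg[OF that]] by (simp add: o_def)
  have expand: "frechet_derivative g (at (f x)) w =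
      (\<Sum>i\<in>Basis. (w \<bullet> i) *\<^sub>R frechet_derivative g (at (f x)) i)" if "x \<in> S" for x w
  proof -
    have "linear (frechet_derivative g (at (f x)))"
      using dg[OF that] has_derivative_linear by blast
    then have "frechet_derivative g (at (f x)) (\<Sum>i\<in>Basis. (w \<bullet> i) *\<^sub>R i) =
        (\<Sum>i\<in>Basis. (w \<bullet> i) *\<^sub>R frechet_derivative g (at (f x)) i)"
      by (simp add: linear_sum linear_cmul)
    then show ?thesis by (simp add: euclidean_representation)
  qed
  have "Ck_on n S (\<lambda>x. frechet_derivative (\<lambda>x. g (f x)) (at x) v)" for v
  proof (rule Ck_on_cong_open[OF assms(1)])
    have inner: "Ck_on n S (\<lambda>x. f' x \<bullet> i)" if "Ck_on n S f'" for f' :: "'a \<Rightarrow> 'b" and i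
      using that
    proof (induction n arbitrary: f')
      case 0
      then show ?case by (auto intro: continuous_intros)
    next
      case (Suc n)
      have d: "((\<lambda>x. f' x \<bullet> i) has_derivative (\<lambda>v. frechet_derivative f' (at x) v \<bullet> i)) (at x)"
        if "x \<in> S" for x
        using Suc.prems that by (auto simp: frechet_derivative_works intro!: has_derivative_inner_left)
      have "Ck_on n S (\<lambda>x. frechet_derivative (\<lambda>x. f' x \<bullet> i) (at x) v)" for v
        by (rule Ck_on_cong_open[OF assms(1) Suc.IH[of "\<lambda>x. frechet_derivative f' (at x) v"]])
           (use Suc.prems in \<open>auto simp: frechet_derivative_at[OF d, symmetric]\<close>)
      then show ?case using d by (auto simp: differentiable_def)
    qed
    show "Ck_on n S (\<lambda>x. \<Sum>i\<in>Basis. (frechet_derivative f (at x) v \<bullet> i) *\<^sub>R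
        frechet_derivative g (at (f x)) i)"
      using Suc.prems Ck_on_SucD[OF Suc.prems(1)]
      by (intro Ck_on_sum Ck_on_scaleR inner Suc.IH assms(1)) auto
  qed (simp add: frechet_derivative_at[OF *, symmetric] expand[symmetric])
  then show ?case using * by (auto simp: differentiable_def)
qed

lemma Ck_on_Pair1: "Ck_on n S (\<lambda>y. (c, y))" for c :: "'a::real_normed_vector"
proof -
  have "bounded_linear (\<lambda>y. (0::'a, y))"
    by (intro bounded_linear_Pair bounded_linear_zero bounded_linear_ident)
  from Ck_on_add[OF open_UNIV Ck_on_const Ck_on_bounded_linear[OF this], of n "(c, 0)"]
  show ?thesis by (auto intro: Ck_on_subset)
qed

lemma Ck_on_Pair2: "Ck_on n S (\<lambda>y. (y, c))" for c :: "'a::real_normed_vector"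
proof -
  have "bounded_linear (\<lambda>y. (y, 0::'a))"
    by (intro bounded_linear_Pair bounded_linear_zero bounded_linear_ident)
  from Ck_on_add[OF open_UNIV Ck_on_const Ck_on_bounded_linear[OF this], of n "(0, c)"]
  show ?thesis by (auto intro: Ck_on_subset)
qed

context lie_group
begin

lemma ex_chart_around: "atlas G \<noteq> {} \<Longrightarrow> \<exists>U \<phi>. (U, \<phi>) \<in> atlas G \<and> g \<in> U"
  using covering by blast

text \<open>Around \<open>t h\<close> there is a chart \<open>\<eta>\<close>, and near \<open>\<psi> h\<close> the function factors as
  \<open>(f \<circ> \<eta>\<inverse>) \<circ> (\<eta> \<circ> t \<circ> \<psi>\<inverse>)\<close>. Continuity of \<open>t\<close> makes the domain of the second factor open.\<close>

lemma smooth_fun_locally_through_chart: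
  assumes f: "smooth_fun G f" and V: "(V, \<psi>) \<in> atlas G"
    and t: "continuous_on UNIV t"
    and loc: "\<And>h W \<eta>. h \<in> V \<Longrightarrow> (W, \<eta>) \<in> atlas G \<Longrightarrow> t h \<in> W \<Longrightarrow>
      open {y \<in> \<psi> ` V. t (inv_into V \<psi> y) \<in> W} \<Longrightarrow>
      smooth_on {y \<in> \<psi> ` V. t (inv_into V \<psi> y) \<in> W} (\<lambda>y. \<eta> (t (inv_into V \<psi> y)))"
  shows "smooth_on (\<psi> ` V) ((\<lambda>h. f (t h)) \<circ> inv_into V \<psi>)"
  unfolding smooth_on_def
proof (intro allI Ck_on_local)
  fix n y assume "y \<in> \<psi> ` V"
  then obtain h where h: "h \<in> V" "y = \<psi> h" by auto
  have hV: "homeomorphism V (\<psi> ` V) \<psi> (inv_into V \<psi>)" "open (\<psi> ` V)"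
    using chart[OF V] by auto
  have iV: "inv_into V \<psi> (\<psi> h) = h" using hV h by (auto simp: homeomorphism_def)
  obtain W \<eta> where W: "(W, \<eta>) \<in> atlas G" "t h \<in> W"
    using ex_chart_around V by blast
  let ?T = "{y \<in> \<psi> ` V. t (inv_into V \<psi> y) \<in> W}"
  have "continuous_on (\<psi> ` V) (\<lambda>y. t (inv_into V \<psi> y))"
    using hV(1) by (auto simp: homeomorphism_def intro: continuous_on_compose2[OF t])
  then have "open (\<psi> ` V \<inter> (\<lambda>y. t (inv_into V \<psi> y)) -` W)"
    using continuous_open_preimage hV(2) chart[OF W(1)] by blast
  moreover have "\<psi> ` V \<inter> (\<lambda>y. t (inv_into V \<psi> y)) -` W = ?T" by blast
  ultimately have oT: "open ?T" by simp
  have "y \<in> ?T" using h W iV by auto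
  moreover have "Ck_on n ?T ((\<lambda>h. f (t h)) \<circ> inv_into V \<psi>)"
  proof (rule Ck_on_cong_open[OF oT])
    have "Ck_on n (\<eta> ` W) (f \<circ> inv_into W \<eta>)"
      using f W(1) by (auto simp: smooth_fun_def smooth_on_def)
    moreover have "Ck_on n ?T (\<lambda>y. \<eta> (t (inv_into V \<psi> y)))"
      using loc[OF h(1) W oT] by (simp add: smooth_on_def)
    ultimately show "Ck_on n ?T (\<lambda>y. (f \<circ> inv_into W \<eta>) (\<eta> (t (inv_into V \<psi> y))))"
      using Ck_on_compose[OF oT, of "\<lambda>y. \<eta> (t (inv_into V \<psi> y))" "\<eta> ` W" n "f \<circ> inv_into W \<eta>"]
      by blast
  next
    fix y assume "y \<in> ?T"
    moreover have "homeomorphism W (\<eta> ` W) \<eta> (inv_into W \<eta>)" using chart[OF W(1)] by auto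
    ultimately show "(f \<circ> inv_into W \<eta>) (\<eta> (t (inv_into V \<psi> y))) = ((\<lambda>h. f (t h)) \<circ> inv_into V \<psi>) y"
      by (auto simp: homeomorphism_def)
  qed
  ultimately show "\<exists>T. open T \<and> y \<in> T \<and> Ck_on n T ((\<lambda>h. f (t h)) \<circ> inv_into V \<psi>)"
    using oT by blast
qed

text \<open>In charts, translation by \<open>g\<close> is the smooth multiplication map with one argument frozen.\<close>

lemma smooth_fun_left_translate:
  assumes "smooth_fun G f" shows "smooth_fun G (\<lambda>h. f (g \<otimes> h))"
  unfolding smooth_fun_def
proof safe
  fix V \<psi> assume V: "(V, \<psi>) \<in> atlas G"
  then obtain U \<phi> where U: "(U, \<phi>) \<in> atlas G" "g \<in> U"
    using ex_chart_around by blast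
  have iU: "inv_into U \<phi> (\<phi> g) = g" using chart[OF U(1)] U(2) by (auto simp: homeomorphism_def)
  show "smooth_on (\<psi> ` V) ((\<lambda>h. f (g \<otimes> h)) \<circ> inv_into V \<psi>)"
  proof (rule smooth_fun_locally_through_chart[OF assms V])
    show c: "continuous_on UNIV (\<lambda>h. g \<otimes> h)"
      using continuous_on_compose2[OF continuous_mult continuous_on_Pair[OF continuous_on_const continuous_on_id]]
      by simp
    fix h W \<eta> assume W: "h \<in> V" "(W, \<eta>) \<in> atlas G" "g \<otimes> h \<in> W"
      and oT: "open {y \<in> \<psi> ` V. g \<otimes> inv_into V \<psi> y \<in> W}"
    let ?T = "{y \<in> \<psi> ` V. g \<otimes> inv_into V \<psi> y \<in> W}"
    let ?D = "{(x, y). x \<in> \<phi> ` U \<and> y \<in> \<psi> ` V \<and> inv_into U \<phi> x \<otimes> inv_into V \<psi> y \<in> W}"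
    have "(\<lambda>y. (\<phi> g, y)) ` ?T \<subseteq> ?D" using U(2) iU by auto
    from Ck_on_compose[OF oT this Ck_on_Pair1] smooth_mult[OF U(1) V W(2)]
    show "smooth_on ?T (\<lambda>y. \<eta> (g \<otimes> inv_into V \<psi> y))"
      unfolding smooth_on_def by (fastforce simp: iU)
  qed
qed

lemma smooth_fun_right_translate:
  assumes "smooth_fun G f" shows "smooth_fun G (\<lambda>h. f (h \<otimes> g))"
  unfolding smooth_fun_def
proof safe
  fix V \<psi> assume V: "(V, \<psi>) \<in> atlas G"
  then obtain U \<phi> where U: "(U, \<phi>) \<in> atlas G" "g \<in> U"
    using ex_chart_around by blast
  have iU: "inv_into U \<phi> (\<phi> g) = g" using chart[OF U(1)] U(2) by (auto simp: homeomorphism_def)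
  show "smooth_on (\<psi> ` V) ((\<lambda>h. f (h \<otimes> g)) \<circ> inv_into V \<psi>)"
  proof (rule smooth_fun_locally_through_chart[OF assms V])
    show c: "continuous_on UNIV (\<lambda>h. h \<otimes> g)"
      using continuous_on_compose2[OF continuous_mult continuous_on_Pair[OF continuous_on_id continuous_on_const]]
      by simp
    fix h W \<eta> assume W: "h \<in> V" "(W, \<eta>) \<in> atlas G" "h \<otimes> g \<in> W"
      and oT: "open {y \<in> \<psi> ` V. inv_into V \<psi> y \<otimes> g \<in> W}"
    let ?T = "{y \<in> \<psi> ` V. inv_into V \<psi> y \<otimes> g \<in> W}"
    let ?D = "{(x, y). x \<in> \<psi> ` V \<and> y \<in> \<phi> ` U \<and> inv_into V \<psi> x \<otimes> inv_into U \<phi> y \<in> W}"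
    have "(\<lambda>y. (y, \<phi> g)) ` ?T \<subseteq> ?D" using U(2) iU by auto
    from Ck_on_compose[OF oT this Ck_on_Pair2] smooth_mult[OF V U(1) W(2)]
    show "smooth_on ?T (\<lambda>y. \<eta> (inv_into V \<psi> y \<otimes> g))"
      unfolding smooth_on_def by (fastforce simp: iU)
  qed
qed

end

section \<open>Formal linear combinations\<close>

lemma teval_superset:
  assumes "finite A" "Poly_Mapping.keys t \<subseteq> A"
  shows "teval B t = (\<Sum>p\<in>A. Poly_Mapping.lookup t p * B p)"
  unfolding teval_def
  by (rule sum.mono_neutral_left[OF assms]) (simp add: in_keys_iff)

lemma teval_add: "teval B (s + t) = teval B s + teval B t"
proof -
  let ?A = "Poly_Mapping.keys s \<union> Poly_Mapping.keys t"
  have "finite ?A" "Poly_Mapping.keys (s + t) \<subseteq> ?A"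
    using Poly_Mapping.keys_add[of s t] by auto
  then show ?thesis
    by (simp add: teval_superset[of ?A] lookup_add algebra_simps sum.distrib)
qed

lemma teval_diff: "teval B (s - t) = teval B s - teval B t"
  using teval_add[of B "s - t" t] by simp

lemma teval_single [simp]: "teval B (Poly_Mapping.single k c) = c * B k"
  by (simp add: teval_superset[of "{k}"])

lemma teval_zero [simp]: "teval B 0 = 0"
  by (simp add: teval_def)

lemma teval_sum: "teval B (\<Sum>i\<in>I. t i) = (\<Sum>i\<in>I. teval B (t i))"
  by (induction I rule: infinite_finite_induct) (simp_all add: teval_add)

lemma teval_tmap: "teval B (tmap h t) = teval (\<lambda>p. B (h p)) t"
  by (simp add: tmap_def teval_sum teval_def[of _ t])

lemma keys_tscale: "Poly_Mapping.keys (tscale c t) \<subseteq> Poly_Mapping.keys t"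
  by (auto simp: tscale_def in_keys_iff map.rep_eq)

lemma teval_tscale: "teval B (tscale c t) = c * teval B t"
  unfolding teval_superset[OF finite_keys keys_tscale]
  by (auto simp: teval_def tscale_def map.rep_eq sum_distrib_left when_def in_keys_iff intro!: sum.cong)

lemma keys_tmap: "Poly_Mapping.keys (tmap h t) \<subseteq> h ` Poly_Mapping.keys t"
  unfolding tmap_def
  by (rule order_trans[OF Poly_Mapping.keys_sum]) (auto split: if_splits)

lemma teval_cong: "(\<And>p. p \<in> Poly_Mapping.keys t \<Longrightarrow> B p = C p) \<Longrightarrow> teval B t = teval C t"
  unfolding teval_def by (rule sum.cong) auto

lemma teval_lin: "teval (\<lambda>p. \<alpha> * B p + \<beta> * C p) t = \<alpha> * teval B t + \<beta> * teval C t"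
  by (simp add: teval_def sum.distrib sum_distrib_left algebra_simps)

lemma teval_diff_fun: "teval (\<lambda>p. B p - C p) t = teval B t - teval C t"
  using teval_lin[of 1 B "-1" C t] by simp

section \<open>Linear functionals on a Hopf algebra of functions\<close>

text \<open>Functionals that arise here, such as tangent vectors, are linear only on smooth functions; this
  notion keeps what is needed of it, and makes evaluations and derivatives instances of the same
  lemmas.\<close>

definition lin_on :: "('g \<Rightarrow> real) set \<Rightarrow> (('g \<Rightarrow> real) \<Rightarrow> real) \<Rightarrow> bool" where
  "lin_on H L \<longleftrightarrow>
     (\<forall>a\<in>H. \<forall>b\<in>H. \<forall>\<alpha> \<beta>. L (\<lambda>g. \<alpha> * a g + \<beta> * b g) = \<alpha> * L a + \<beta> * L b)"

lemma lin_onD: "lin_on H L \<Longrightarrow> a \<in> H \<Longrightarrow> b \<in> H \<Longrightarrow> L (\<lambda>g. \<alpha> * a g + \<beta> * b g) = \<alpha> * L a + \<beta> * L b"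
  by (auto simp: lin_on_def)

context lie_group
begin

lemma mult_assoc [simp]: "(x \<otimes> y) \<otimes> z = x \<otimes> (y \<otimes> z)"
  by (rule m_assoc) (auto simp: carrier_UNIV)

lemma mult_one [simp]: "\<one> \<otimes> x = x" "x \<otimes> \<one> = x"
  by (auto simp: carrier_UNIV)

lemma mult_inv_cancel [simp]:
  "inv x \<otimes> (x \<otimes> y) = y" "x \<otimes> (inv x \<otimes> y) = y" "inv x \<otimes> x = \<one>" "x \<otimes> inv x = \<one>"
  using mult_assoc[of "inv x" x y] mult_assoc[of x "inv x" y] by (auto simp: carrier_UNIV simp del: mult_assoc)

lemma smooth_fun_left_translate_iff: "smooth_fun G (\<lambda>h. f (g \<otimes> h)) \<longleftrightarrow> smooth_fun G f"
  using smooth_fun_left_translate[of f g] smooth_fun_left_translate[of "\<lambda>h. f (g \<otimes> h)" "inv g"]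
  by auto

lemma smooth_fun_right_translate_iff: "smooth_fun G (\<lambda>h. f (h \<otimes> g)) \<longleftrightarrow> smooth_fun G f"
  using smooth_fun_right_translate[of f g] smooth_fun_right_translate[of "\<lambda>h. f (h \<otimes> g)" "inv g"]
  by auto

lemma lpush_tangent: "x \<in> tangent G h \<Longrightarrow> lpush G g x \<in> tangent G (g \<otimes> h)"
  by (auto simp: tangent_def lpush_def smooth_fun_left_translate_iff)

lemma rpush_tangent: "x \<in> tangent G h \<Longrightarrow> rpush G g x \<in> tangent G (h \<otimes> g)"
  by (auto simp: tangent_def rpush_def smooth_fun_right_translate_iff)

lemma lpush_one [simp]: "lpush G \<one> x = x" and rpush_one [simp]: "rpush G \<one> x = x"
  by (auto simp: lpush_def rpush_def)

lemma lpush_lpush: "lpush G g (lpush G h x) = lpush G (g \<otimes> h) x"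
  by (simp add: lpush_def)

lemma lpush_lie_alg: "v \<in> lie_alg G \<Longrightarrow> lpush G g v \<in> tangent G g"
  using lpush_tangent[of v \<one> g] by (simp add: lie_alg_def)

lemma U_pair_append: "U_pair G (p @ q) a = U_pair G p (\<lambda>g. U_pair G q (\<lambda>h. a (g \<otimes> h)))"
  by (induction p arbitrary: a) simp_all

end

locale hopf_functions = lie_group G
  for G :: "('g::{t2_space, second_countable_topology}, 'e::euclidean_space, 'm) lie_data_scheme"
    (structure) +
  fixes H :: "('g \<Rightarrow> real) set"
  assumes hopf: "function_hopf_algebra G H"
begin

lemma H_smooth: "a \<in> H \<Longrightarrow> smooth_fun G a"
  and H_one: "(\<lambda>g. 1) \<in> H"
  and H_mult: "a \<in> H \<Longrightarrow> b \<in> H \<Longrightarrow> (\<lambda>g. a g * b g) \<in> H"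
  and H_lin: "a \<in> H \<Longrightarrow> b \<in> H \<Longrightarrow> (\<lambda>g. \<alpha> * a g + \<beta> * b g) \<in> H"
  and H_inv: "a \<in> H \<Longrightarrow> (\<lambda>g. a (inv g)) \<in> H"
  using hopf by (auto simp: function_hopf_algebra_def)

lemma H_scale: "a \<in> H \<Longrightarrow> (\<lambda>g. c * a g) \<in> H"
  using H_lin[of a a c 0] by simp

lemma H_sum_list: "(\<And>z. z \<in> set zs \<Longrightarrow> u z \<in> H) \<Longrightarrow> (\<lambda>h. \<Sum>z\<leftarrow>zs. c z * u z h) \<in> H"
proof (induction zs)
  case Nil
  show ?case using H_scale[OF H_one, of 0] by simp
next
  case (Cons z zs)
  then show ?case using H_lin[of "u z" "\<lambda>h. \<Sum>z\<leftarrow>zs. c z * u z h" "c z" 1] by simp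
qed

lemma lin_scale: "lin_on H L \<Longrightarrow> a \<in> H \<Longrightarrow> L (\<lambda>g. c * a g) = c * L a"
  using lin_onD[of H L a a c 0] by simp

lemma lin_sum_list:
  assumes "lin_on H L" "\<And>z. z \<in> set zs \<Longrightarrow> u z \<in> H"
  shows "L (\<lambda>h. \<Sum>z\<leftarrow>zs. c z * u z h) = (\<Sum>z\<leftarrow>zs. c z * L (u z))"
  using assms(2)
proof (induction zs)
  case Nil
  show ?case using lin_scale[OF assms(1) H_one, of 0] by simp
next
  case (Cons z zs)
  then show ?case
    using lin_onD[OF assms(1), of "u z" "\<lambda>h. \<Sum>z\<leftarrow>zs. c z * u z h" "c z" 1] H_sum_list[of zs u c] by simp
qed

lemma H_sum: "(\<And>i. i \<in> I \<Longrightarrow> u i \<in> H) \<Longrightarrow> (\<lambda>g. \<Sum>i\<in>I. c i * u i g) \<in> H"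
proof (induction I rule: infinite_finite_induct)
  case (insert i I)
  then show ?case using H_lin[of "u i" "\<lambda>g. \<Sum>i\<in>I. c i * u i g" "c i" 1] by simp
qed (use H_scale[OF H_one, of 0] in simp_all)

lemma lin_teval:
  assumes "lin_on H L" "\<And>p. p \<in> Poly_Mapping.keys t \<Longrightarrow> u p \<in> H"
  shows "L (\<lambda>g. teval (\<lambda>p. u p g) t) = teval (\<lambda>p. L (u p)) t"
proof -
  have "L (\<lambda>g. \<Sum>p\<in>I. c p * u p g) = (\<Sum>p\<in>I. c p * L (u p))"
    if "I \<subseteq> Poly_Mapping.keys t" for I c
    using finite_subset[OF that finite_keys] that
  proof (induction I)
    case empty
    show ?case using lin_scale[OF assms(1) H_one, of 0] by simp
  next
    case (insert i I)
    then have "u i \<in> H" "(\<lambda>g. \<Sum>p\<in>I. c p * u p g) \<in> H"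
      using assms(2) by (auto intro!: H_sum)
    from lin_onD[OF assms(1) this, of "c i" 1] insert show ?case by simp
  qed
  then show ?thesis by (simp add: teval_def)
qed

lemma coprod_eq: "a \<in> H \<Longrightarrow> a (g \<otimes> h) = (\<Sum>z\<leftarrow>coprod G H a. fst z g * snd z h)"
  and coprod_mem: "a \<in> H \<Longrightarrow> z \<in> set (coprod G H a) \<Longrightarrow> fst z \<in> H \<and> snd z \<in> H"
proof -
  have "is_coproduct G H a (coprod G H a)" if "a \<in> H"
    unfolding coprod_def using hopf that by (auto simp: function_hopf_algebra_def intro: someI_ex)
  then show "a \<in> H \<Longrightarrow> a (g \<otimes> h) = (\<Sum>z\<leftarrow>coprod G H a. fst z g * snd z h)"
    "a \<in> H \<Longrightarrow> z \<in> set (coprod G H a) \<Longrightarrow> fst z \<in> H \<and> snd z \<in> H"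
    by (auto simp: is_coproduct_def split_def)
qed

text \<open>The coproduct turns a translate of \<open>a\<close> into a finite combination of fixed functions in \<open>H\<close>. Any
  functional linear on \<open>H\<close> can therefore be applied to translates termwise, without any analysis.\<close>

lemma lin_right_translate:
  assumes "lin_on H L" "a \<in> H"
  shows "L (\<lambda>h. a (g \<otimes> h)) = (\<Sum>z\<leftarrow>coprod G H a. L (snd z) * fst z g)"
  using lin_sum_list[OF assms(1), of "coprod G H a" snd "\<lambda>z. fst z g"] coprod_mem[OF assms(2)]
  by (simp add: coprod_eq[OF assms(2)] mult.commute)

lemma lin_left_translate:
  assumes "lin_on H L" "a \<in> H"
  shows "L (\<lambda>g. a (g \<otimes> h)) = (\<Sum>z\<leftarrow>coprod G H a. L (fst z) * snd z h)"
  using lin_sum_list[OF assms(1), of "coprod G H a" fst "\<lambda>z. snd z h"] coprod_mem[OF assms(2)]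
  by (simp add: coprod_eq[OF assms(2)] mult.commute)

lemma H_right_convolve: "lin_on H L \<Longrightarrow> a \<in> H \<Longrightarrow> (\<lambda>g. L (\<lambda>h. a (g \<otimes> h))) \<in> H"
  using H_sum_list[of "coprod G H a" fst "\<lambda>z. L (snd z)"] coprod_mem[of a]
  by (simp add: lin_right_translate)

lemma H_left_convolve: "lin_on H L \<Longrightarrow> a \<in> H \<Longrightarrow> (\<lambda>h. L (\<lambda>g. a (g \<otimes> h))) \<in> H"
  using H_sum_list[of "coprod G H a" snd "\<lambda>z. L (fst z)"] coprod_mem[of a]
  by (simp add: lin_left_translate)

text \<open>Both sides are \<open>\<Sum> L(a\<^sub>1) K(a\<^sub>2)\<close>. For tangent vectors this is the symmetry of mixed derivatives.\<close>

lemma lin_exchange: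
  assumes "lin_on H L" "lin_on H K" "a \<in> H"
  shows "L (\<lambda>g. K (\<lambda>h. a (g \<otimes> h))) = K (\<lambda>h. L (\<lambda>g. a (g \<otimes> h)))"
proof -
  have "L (\<lambda>g. K (\<lambda>h. a (g \<otimes> h))) = (\<Sum>z\<leftarrow>coprod G H a. K (snd z) * L (fst z))"
    using lin_sum_list[OF assms(1), of "coprod G H a" fst "\<lambda>z. K (snd z)"] coprod_mem[OF assms(3)]
    by (simp add: lin_right_translate assms)
  also have "\<dots> = K (\<lambda>h. L (\<lambda>g. a (g \<otimes> h)))"
    using lin_sum_list[OF assms(2), of "coprod G H a" snd "\<lambda>z. L (fst z)"] coprod_mem[OF assms(3)]
    by (simp add: lin_left_translate assms mult.commute)
  finally show ?thesis .
qed

lemma lin_on_point: "lin_on H (\<lambda>a. a g)"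
  by (simp add: lin_on_def)

lemma H_left_translate: "a \<in> H \<Longrightarrow> (\<lambda>h. a (g \<otimes> h)) \<in> H"
  using H_left_convolve[OF lin_on_point] by simp

lemma H_right_translate: "a \<in> H \<Longrightarrow> (\<lambda>h. a (h \<otimes> g)) \<in> H"
  using H_right_convolve[OF lin_on_point] by simp

lemma lin_on_tangent: "x \<in> tangent G g \<Longrightarrow> lin_on H x"
  using H_smooth by (auto simp: lin_on_def tangent_def)

lemma lin_on_lie_alg: "v \<in> lie_alg G \<Longrightarrow> lin_on H v"
  by (simp add: lie_alg_def lin_on_tangent)

lemma tangent_mult:
  "x \<in> tangent G g \<Longrightarrow> a \<in> H \<Longrightarrow> b \<in> H \<Longrightarrow> x (\<lambda>h. a h * b h) = a g * x b + x a * b g"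
  using H_smooth by (auto simp: tangent_def)

lemma tangent_const: "x \<in> tangent G g \<Longrightarrow> x (\<lambda>h. c) = 0"
  using tangent_mult[of x g "\<lambda>_. 1" "\<lambda>_. 1"] lin_scale[OF lin_on_tangent H_one, of x g c] H_one by simp

lemma lie_alg_mult:
  "v \<in> lie_alg G \<Longrightarrow> a \<in> H \<Longrightarrow> b \<in> H \<Longrightarrow> v (\<lambda>h. a h * b h) = a \<one> * v b + v a * b \<one>"
  by (simp add: lie_alg_def tangent_mult)

text \<open>Differentiate the constant function \<open>g \<mapsto> a(g g\<inverse>) = \<Sum> a\<^sub>1(g) a\<^sub>2(g\<inverse>)\<close> at the unit with the product rule.\<close>

lemma lie_alg_inv:
  assumes v: "v \<in> lie_alg G" and a: "a \<in> H"
  shows "v (\<lambda>g. a (inv g)) = - v a"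
proof -
  note lv = lin_on_lie_alg[OF v]
  have mem: "fst z \<in> H" "snd z \<in> H" "(\<lambda>g. snd z (inv g)) \<in> H" "(\<lambda>g. fst z g * snd z (inv g)) \<in> H"
    if "z \<in> set (coprod G H a)" for z
    using coprod_mem[OF a that] by (auto simp: H_mult H_inv)
  have "0 = v (\<lambda>g. a (g \<otimes> inv g))"
    using tangent_const[of v \<one> "a \<one>"] v by (simp add: lie_alg_def)
  also have "\<dots> = (\<Sum>z\<leftarrow>coprod G H a. v (\<lambda>g. fst z g * snd z (inv g)))"
    using lin_sum_list[OF lv, of "coprod G H a" "\<lambda>z g. fst z g * snd z (inv g)" "\<lambda>_. 1"] mem
    by (simp add: coprod_eq[OF a] del: mult_inv_cancel)
  also have "\<dots> = (\<Sum>z\<leftarrow>coprod G H a. fst z \<one> * v (\<lambda>g. snd z (inv g)) + snd z \<one> * v (fst z))"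
    by (intro arg_cong[where f = sum_list] map_cong refl)
       (simp add: lie_alg_mult[OF v] mem carrier_UNIV)
  also have "\<dots> = (\<Sum>z\<leftarrow>coprod G H a. fst z \<one> * v (\<lambda>g. snd z (inv g))) + (\<Sum>z\<leftarrow>coprod G H a. snd z \<one> * v (fst z))"
    by (simp add: sum_list_addf)
  also have "(\<Sum>z\<leftarrow>coprod G H a. fst z \<one> * v (\<lambda>g. snd z (inv g))) = v (\<lambda>g. a (\<one> \<otimes> inv g))"
    using lin_sum_list[OF lv, of "coprod G H a" "\<lambda>z g. snd z (inv g)" "\<lambda>z. fst z \<one>"] mem
    by (simp add: coprod_eq[OF a] del: mult_one)
  also have "(\<Sum>z\<leftarrow>coprod G H a. snd z \<one> * v (fst z)) = v (\<lambda>g. a (g \<otimes> \<one>))"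
    using lin_left_translate[OF lv a, of \<one>] by (simp add: mult.commute)
  finally show ?thesis by simp
qed

section \<open>The pairing with the enveloping algebra\<close>

lemma lin_on_U_pair: "set p \<subseteq> lie_alg G \<Longrightarrow> lin_on H (U_pair G p)"
proof (induction p)
  case (Cons v p)
  then have "lin_on H (U_pair G p)" "lin_on H v" by (auto simp: lin_on_lie_alg)
  then show ?case
    by (auto simp: lin_on_def lin_onD H_left_translate H_right_convolve)
qed (simp add: lin_on_def)

text \<open>The left part \<open>p\<close> of the word is applied to the function produced by the rest, which lies in \<open>H\<close>, so
  linearity in the letter passes through \<open>p\<close>.\<close>

lemma U_pair_letter_linear:
  assumes "set p \<subseteq> lie_alg G" "set q \<subseteq> lie_alg G" "v \<in> lie_alg G" "w \<in> lie_alg G" "a \<in> H"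
  shows "U_pair G (p @ (\<lambda>f. \<alpha> * v f + \<beta> * w f) # q) a =
    \<alpha> * U_pair G (p @ v # q) a + \<beta> * U_pair G (p @ w # q) a"
proof -
  have "(\<lambda>g. U_pair G (u # q) (\<lambda>h. a (g \<otimes> h))) \<in> H" if "u \<in> lie_alg G" for u
    using assms that by (intro H_right_convolve lin_on_U_pair) auto
  from lin_onD[OF lin_on_U_pair[OF assms(1)] this[OF assms(3)] this[OF assms(4)]]
  show ?thesis by (simp add: U_pair_append)
qed

text \<open>The definition of the Lie bracket is the commutator of left invariant fields at the unit. Applied to
  the left translate by \<open>g\<close> of the function produced by \<open>q\<close>, it gives the commutator at \<open>g\<close>, to which
  \<open>p\<close> is applied afterwards.\<close>

lemma U_pair_bracket:
  assumes "set p \<subseteq> lie_alg G" "set q \<subseteq> lie_alg G" "v \<in> lie_alg G" "w \<in> lie_alg G" "a \<in> H"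
  shows "U_pair G (p @ v # w # q) a - U_pair G (p @ w # v # q) a = U_pair G (p @ lie_bracket G v w # q) a"
proof -
  have "(\<lambda>g. U_pair G (u # u' # q) (\<lambda>h. a (g \<otimes> h))) \<in> H" if "u \<in> lie_alg G" "u' \<in> lie_alg G" for u u'
    using assms that by (intro H_right_convolve lin_on_U_pair) auto
  note H = this[OF assms(3,4)] this[OF assms(4,3)]
  have "(\<lambda>k. U_pair G q (\<lambda>h. a (g \<otimes> (k \<otimes> h)))) \<in> H" for g
    using H_right_convolve[OF lin_on_U_pair[OF assms(2)] H_left_translate[OF assms(5)]] by simp
  then have "lie_bracket G v w (\<lambda>k. U_pair G q (\<lambda>h. a (g \<otimes> (k \<otimes> h)))) =
      U_pair G (v # w # q) (\<lambda>h. a (g \<otimes> h)) - U_pair G (w # v # q) (\<lambda>h. a (g \<otimes> h))" for g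
    using H_smooth by (simp add: lie_bracket_def lpush_def)
  then show ?thesis
    using lin_onD[OF lin_on_U_pair[OF assms(1)] H, of 1 "-1"] by (simp add: U_pair_append)
qed

definition pair2 :: "('g \<Rightarrow> real) \<Rightarrow> ('g \<Rightarrow> real) \<Rightarrow> 'g utens \<Rightarrow> real" where
  "pair2 a b = teval (\<lambda>p. U_pair G (p ! 0) a * U_pair G (p ! 1) b)"

text \<open>Hence the pairing with \<open>H \<otimes> H\<close> is well defined on the tensor square of the enveloping algebra.\<close>

lemma pair2_U_null:
  assumes "t \<in> U_null G 2" "a \<in> H" "b \<in> H"
  shows "pair2 a b t = 0"
  using assms(1) unfolding pair2_def
proof (induction rule: U_null.induct)
  case (linear v w P p q Q \<alpha> \<beta>)
  consider u where "P = []" "Q = [u]" | u where "P = [u]" "Q = []"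
    using linear(4) by (cases P; cases Q) auto
  then show ?case
    by cases (use linear assms(2,3) in \<open>simp_all add: teval_diff teval_add U_pair_letter_linear algebra_simps\<close>)
next
  case (bracket v w P p q Q)
  consider u where "P = []" "Q = [u]" | u where "P = [u]" "Q = []"
    using bracket(4) by (cases P; cases Q) auto
  then show ?case
    by cases (use bracket assms(2,3) in \<open>simp_all add: teval_diff teval_add U_pair_bracket[symmetric] algebra_simps\<close>)
qed (simp_all add: teval_add teval_tscale)

lemma pair2_U_eq: "U_eq G 2 s t \<Longrightarrow> a \<in> H \<Longrightarrow> b \<in> H \<Longrightarrow> pair2 a b s = pair2 a b t"
  using pair2_U_null[of "s - t" a b] by (simp add: U_eq_def pair2_def teval_diff)

lemma pair2_add: "pair2 a b (s + t) = pair2 a b s + pair2 a b t"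
  and pair2_diff: "pair2 a b (s - t) = pair2 a b s - pair2 a b t"
  by (simp_all add: pair2_def teval_add teval_diff)

lemma pair2_one2: "pair2 a b U_one2 = a \<one> * b \<one>"
  by (simp add: pair2_def U_one2_def)

lemma pair2_flip: "t \<in> U_elems G 2 \<Longrightarrow> pair2 a b (U_flip t) = pair2 b a t"
  by (auto simp: pair2_def U_flip_def teval_tmap U_elems_def rev_nth intro!: teval_cong)

lemma pair2_lie2_U: "pair2 a b (lie2_U t) = teval (\<lambda>(v, w). v a * w b) t"
  by (auto simp: pair2_def lie2_U_def teval_tmap intro!: teval_cong)

lemma teval_r_plus: "teval B (r_plus r) = (teval B r + teval (\<lambda>p. B (prod.swap p)) r) / 2"
  by (simp add: r_plus_def teval_tscale teval_add teval_tmap)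

lemma teval_r_minus: "teval B (r_minus r) = (teval B r - teval (\<lambda>p. B (prod.swap p)) r) / 2"
  by (simp add: r_minus_def teval_tscale teval_diff teval_tmap)

lemma teval_r_minus_swap: "teval (\<lambda>p. B (prod.swap p)) (r_minus r) = - teval B (r_minus r)"
  by (simp add: teval_r_minus field_simps)

lemma r_minus_keys: "r \<in> lie2_elems G \<Longrightarrow> Poly_Mapping.keys (r_minus r) \<subseteq> lie_alg G \<times> lie_alg G"
  using keys_tscale[of "1/2" "r - tmap prod.swap r"] keys_diff[of r "tmap prod.swap r"]
    keys_tmap[of prod.swap r]
  unfolding lie2_elems_def r_minus_def by fastforce

end

lemma fps_nth_sum_list: "fps_nth (\<Sum>z\<leftarrow>zs. f z) n = (\<Sum>z\<leftarrow>zs. fps_nth (f z) n)"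
  by (induction zs) simp_all

lemma sum_list_product:
  "(\<Sum>(x, y)\<leftarrow>List.product xs ys. f x y) = (\<Sum>x\<leftarrow>xs. \<Sum>y\<leftarrow>ys. f x y)"
  by (induction xs) (simp_all add: o_def)

lemma sum_list_times_sum_list:
  "(\<Sum>x\<leftarrow>xs. f x) * (\<Sum>y\<leftarrow>ys. g y) = (\<Sum>x\<leftarrow>xs. \<Sum>y\<leftarrow>ys. f x * (g y :: 'a::semiring_0))"
  by (simp add: sum_list_const_mult sum_list_mult_const)

lemma sum_list_concat_map: "(\<Sum>z\<leftarrow>concat (map f xs). g z) = (\<Sum>x\<leftarrow>xs. \<Sum>z\<leftarrow>f x. g z)"
  by (induction xs) simp_all

section \<open>Forms and coactions\<close>

lemma forms_add: "\<sigma> \<in> forms H \<Longrightarrow> \<tau> \<in> forms H \<Longrightarrow> (\<lambda>g x. \<sigma> g x + \<tau> g x) \<in> forms H"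
proof -
  assume "\<sigma> \<in> forms H" "\<tau> \<in> forms H"
  then obtain xs ys where "set xs \<subseteq> H \<times> H" "\<sigma> = (\<lambda>g x. \<Sum>(a, b)\<leftarrow>xs. a g * dform b g x)"
    "set ys \<subseteq> H \<times> H" "\<tau> = (\<lambda>g x. \<Sum>(a, b)\<leftarrow>ys. a g * dform b g x)"
    by (auto simp: forms_def)
  then have "set (xs @ ys) \<subseteq> H \<times> H"
    "(\<lambda>g x. \<sigma> g x + \<tau> g x) = (\<lambda>g x. \<Sum>(a, b)\<leftarrow>xs @ ys. a g * dform b g x)"
    by auto
  then show ?thesis unfolding forms_def by blast
qed

lemma forms_zero: "(\<lambda>g x. 0) \<in> forms H"
  by (auto simp: forms_def intro!: exI[of _ "[]"])

lemma forms_basic: "a \<in> H \<Longrightarrow> b \<in> H \<Longrightarrow> (\<lambda>g x. a g * dform b g x) \<in> forms H"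
  by (auto simp: forms_def intro!: exI[of _ "[(a, b)]"])

lemma forms_induct [consumes 1, case_names zero step]:
  assumes "\<tau> \<in> forms H" "Q (\<lambda>g x. 0)"
    "\<And>a b \<sigma>. a \<in> H \<Longrightarrow> b \<in> H \<Longrightarrow> \<sigma> \<in> forms H \<Longrightarrow> Q \<sigma> \<Longrightarrow> Q (\<lambda>g x. a g * dform b g x + \<sigma> g x)"
  shows "Q \<tau>"
proof -
  have "Q (\<lambda>g x. \<Sum>(a, b)\<leftarrow>xs. a g * dform b g x)" if "set xs \<subseteq> H \<times> H" for xs
    using that
  proof (induction xs)
    case (Cons z xs)
    then have "(\<lambda>g x. \<Sum>(a, b)\<leftarrow>xs. a g * dform b g x) \<in> forms H"
      by (auto simp: forms_def)
    with Cons assms(3) show ?case by (cases z) simp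
  qed (simp add: assms(2))
  then show ?thesis using assms(1) by (auto simp: forms_def)
qed

context hopf_functions
begin

lemma forms_mult_fun:
  assumes "c \<in> H" "\<tau> \<in> forms H" shows "(\<lambda>g x. c g * \<tau> g x) \<in> forms H"
  using assms(2)
proof (induction rule: forms_induct)
  case (step a b \<sigma>)
  then have "(\<lambda>g x. (c g * a g) * dform b g x + c g * \<sigma> g x) \<in> forms H"
    using assms(1) by (intro forms_add forms_basic H_mult) auto
  then show ?case by (simp add: algebra_simps)
qed (simp add: forms_zero)

lemma forms_scale: "\<tau> \<in> forms H \<Longrightarrow> (\<lambda>g x. c * \<tau> g x) \<in> forms H"
  using forms_mult_fun[of "\<lambda>_. c" \<tau>] H_scale[OF H_one, of c] by simp

lemma forms_lin: "\<sigma> \<in> forms H \<Longrightarrow> \<tau> \<in> forms H \<Longrightarrow> (\<lambda>g x. \<alpha> * \<sigma> g x + \<beta> * \<tau> g x) \<in> forms H"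
  by (intro forms_add forms_scale)

lemma forms_diff: "\<sigma> \<in> forms H \<Longrightarrow> \<tau> \<in> forms H \<Longrightarrow> (\<lambda>g x. \<sigma> g x - \<tau> g x) \<in> forms H"
  using forms_lin[of \<sigma> \<tau> 1 "-1"] by simp

lemma forms_dform: "b \<in> H \<Longrightarrow> dform b \<in> forms H"
  using forms_basic[OF H_one, of b] by simp

lemma forms_sum_list: "(\<And>z. z \<in> set zs \<Longrightarrow> \<tau> z \<in> forms H) \<Longrightarrow> (\<lambda>g x. \<Sum>z\<leftarrow>zs. \<tau> z g x) \<in> forms H"
  by (induction zs) (auto simp: forms_zero intro!: forms_add)

text \<open>For \<open>\<tau> = a db\<close> the coaction is \<open>\<Sum> a\<^sub>1 b\<^sub>1 \<otimes> a\<^sub>2 db\<^sub>2\<close>; the translation acts on \<open>db\<close> through its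
  function \<open>b\<close>. The existence of some decomposition gives meaning to the chosen one in the definition.\<close>

lemma coact_left_exists:
  "\<tau> \<in> forms H \<Longrightarrow> \<exists>ys. set ys \<subseteq> H \<times> forms H \<and>
     (\<forall>g h. \<forall>x\<in>tangent G h. \<tau> (g \<otimes> h) (lpush G g x) = (\<Sum>(a, \<sigma>)\<leftarrow>ys. a g * \<sigma> h x))"
proof (induction rule: forms_induct)
  case zero
  show ?case by (auto intro!: exI[of _ "[]"])
next
  case (step a b \<sigma>)
  then obtain ys where ys: "set ys \<subseteq> H \<times> forms H"
    "\<And>g h x. x \<in> tangent G h \<Longrightarrow> \<sigma> (g \<otimes> h) (lpush G g x) = (\<Sum>(a, \<sigma>)\<leftarrow>ys. a g * \<sigma> h x)"
    by auto
  let ?zs = "map (\<lambda>(p, q). (\<lambda>g. fst p g * fst q g, \<lambda>h x. snd p h * dform (snd q) h x))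
    (List.product (coprod G H a) (coprod G H b))"
  have "set ?zs \<subseteq> H \<times> forms H"
    using coprod_mem[OF step(1)] coprod_mem[OF step(2)] by (fastforce intro: H_mult forms_basic)
  moreover have "a (g \<otimes> h) * dform b (g \<otimes> h) (lpush G g x) = (\<Sum>(a, \<sigma>)\<leftarrow>?zs. a g * \<sigma> h x)"
    if x: "x \<in> tangent G h" for g h x
  proof -
    have "a (g \<otimes> h) * dform b (g \<otimes> h) (lpush G g x) =
        (\<Sum>p\<leftarrow>coprod G H a. fst p g * snd p h) * (\<Sum>q\<leftarrow>coprod G H b. x (snd q) * fst q g)"
      by (simp add: dform_def lpush_def coprod_eq[OF step(1)] lin_right_translate[OF lin_on_tangent[OF x] step(2)])
    also have "\<dots> = (\<Sum>(p, q)\<leftarrow>List.product (coprod G H a) (coprod G H b).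
        fst p g * fst q g * (snd p h * dform (snd q) h x))"
      by (simp add: sum_list_product sum_list_times_sum_list dform_def mult_ac)
    finally show ?thesis by (simp add: split_def o_def)
  qed
  ultimately show ?case
    using ys by (intro exI[of _ "?zs @ ys"]) auto
qed

text \<open>For \<open>\<tau> = a db\<close> the coaction is \<open>\<Sum> a\<^sub>1 db\<^sub>1 \<otimes> a\<^sub>2 b\<^sub>2\<close>.\<close>

lemma coact_right_exists:
  "\<tau> \<in> forms H \<Longrightarrow> \<exists>ys. set ys \<subseteq> forms H \<times> H \<and>
     (\<forall>g h. \<forall>x\<in>tangent G g. \<tau> (g \<otimes> h) (rpush G h x) = (\<Sum>(\<sigma>, a)\<leftarrow>ys. \<sigma> g x * a h))"
proof (induction rule: forms_induct)
  case zero
  show ?case by (auto intro!: exI[of _ "[]"])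
next
  case (step a b \<sigma>)
  then obtain ys where ys: "set ys \<subseteq> forms H \<times> H"
    "\<And>g h x. x \<in> tangent G g \<Longrightarrow> \<sigma> (g \<otimes> h) (rpush G h x) = (\<Sum>(\<sigma>, a)\<leftarrow>ys. \<sigma> g x * a h)"
    by auto
  let ?zs = "map (\<lambda>(p, q). (\<lambda>h x. fst p h * dform (fst q) h x, \<lambda>g. snd p g * snd q g))
    (List.product (coprod G H a) (coprod G H b))"
  have "set ?zs \<subseteq> forms H \<times> H"
    using coprod_mem[OF step(1)] coprod_mem[OF step(2)] by (fastforce intro: H_mult forms_basic)
  moreover have "a (g \<otimes> h) * dform b (g \<otimes> h) (rpush G h x) = (\<Sum>(\<sigma>, a)\<leftarrow>?zs. \<sigma> g x * a h)"
    if x: "x \<in> tangent G g" for g h x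
  proof -
    have "a (g \<otimes> h) * dform b (g \<otimes> h) (rpush G h x) =
        (\<Sum>p\<leftarrow>coprod G H a. fst p g * snd p h) * (\<Sum>q\<leftarrow>coprod G H b. x (fst q) * snd q h)"
      by (simp add: dform_def rpush_def coprod_eq[OF step(1)] lin_left_translate[OF lin_on_tangent[OF x] step(2)])
    also have "\<dots> = (\<Sum>(p, q)\<leftarrow>List.product (coprod G H a) (coprod G H b).
        fst p g * dform (fst q) g x * (snd p h * snd q h))"
      by (simp add: sum_list_product sum_list_times_sum_list dform_def mult_ac)
    finally show ?thesis by (simp add: split_def o_def)
  qed
  ultimately show ?case
    using ys by (intro exI[of _ "?zs @ ys"]) auto
qed

lemma coact_left_mem: "\<tau> \<in> forms H \<Longrightarrow> z \<in> set (coact_left G H \<tau>) \<Longrightarrow> fst z \<in> H \<and> snd z \<in> forms H"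
  and coact_left_eq: "\<tau> \<in> forms H \<Longrightarrow> x \<in> tangent G h \<Longrightarrow>
    \<tau> (g \<otimes> h) (lpush G g x) = (\<Sum>z\<leftarrow>coact_left G H \<tau>. fst z g * snd z h x)"
  using someI_ex[OF coact_left_exists[of \<tau>], folded coact_left_def] by (auto simp: split_def)

lemma coact_right_mem: "\<tau> \<in> forms H \<Longrightarrow> z \<in> set (coact_right G H \<tau>) \<Longrightarrow> fst z \<in> forms H \<and> snd z \<in> H"
  and coact_right_eq: "\<tau> \<in> forms H \<Longrightarrow> x \<in> tangent G g \<Longrightarrow>
    \<tau> (g \<otimes> h) (rpush G h x) = (\<Sum>z\<leftarrow>coact_right G H \<tau>. fst z g x * snd z h)"
  using someI_ex[OF coact_right_exists[of \<tau>], folded coact_right_def] by (auto simp: split_def)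

lemma H_form_left_translate: "\<tau> \<in> forms H \<Longrightarrow> x \<in> tangent G g \<Longrightarrow> (\<lambda>k. \<tau> (k \<otimes> g) (lpush G k x)) \<in> H"
  using H_sum_list[of "coact_left G H \<tau>" fst "\<lambda>z. snd z g x"] coact_left_mem
  by (simp add: coact_left_eq mult.commute)

lemma H_form_right_translate: "\<tau> \<in> forms H \<Longrightarrow> x \<in> tangent G g \<Longrightarrow> (\<lambda>k. \<tau> (g \<otimes> k) (rpush G k x)) \<in> H"
  using H_sum_list[of "coact_right G H \<tau>" snd "\<lambda>z. fst z g x"] coact_right_mem
  by (simp add: coact_right_eq)

lemma coprod3_eq:
  assumes a: "a \<in> H"
  shows "a (k \<otimes> (g \<otimes> h)) = (\<Sum>z\<leftarrow>coprod3 G H a. fst z k * fst (snd z) g * snd (snd z) h)"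
proof -
  have "a (k \<otimes> (g \<otimes> h)) = (\<Sum>z\<leftarrow>coprod G H a. fst z k * snd z (g \<otimes> h))"
    by (rule coprod_eq[OF a])
  also have "\<dots> = (\<Sum>z\<leftarrow>coprod G H a. \<Sum>y\<leftarrow>coprod G H (snd z). fst z k * (fst y g * snd y h))"
  proof (intro arg_cong[where f = sum_list] map_cong refl)
    fix z assume "z \<in> set (coprod G H a)"
    then have "snd z \<in> H" using coprod_mem[OF a] by blast
    from coprod_eq[OF this, of g h]
    show "fst z k * snd z (g \<otimes> h) = (\<Sum>y\<leftarrow>coprod G H (snd z). fst z k * (fst y g * snd y h))"
      by (simp add: sum_list_const_mult)
  qed
  finally show ?thesis
    by (simp add: coprod3_def sum_list_concat_map split_def o_def mult.assoc)
qed

lemma coprod3_mem: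
  assumes "a \<in> H" "z \<in> set (coprod3 G H a)"
  shows "fst z \<in> H \<and> fst (snd z) \<in> H \<and> snd (snd z) \<in> H"
proof -
  obtain p q where "p \<in> set (coprod G H a)" "q \<in> set (coprod G H (snd p))" "z = (fst p, fst q, snd q)"
    using assms(2) by (auto simp: coprod3_def split_def)
  with coprod_mem[OF assms(1)] coprod_mem[of "snd p" q] show ?thesis by auto
qed

text \<open>The right coaction is used on the vector \<open>x\<close> at \<open>g\<close>, but the left one on its right translate at
  \<open>gh\<close>; that this is again a tangent vector is where smoothness of translations enters.\<close>

lemma coact3_eq:
  assumes \<tau>: "\<tau> \<in> forms H" and x: "x \<in> tangent G g"
  shows "\<tau> (k \<otimes> (g \<otimes> h)) (lpush G k (rpush G h x)) =
    (\<Sum>z\<leftarrow>coact3 G H \<tau>. fst z k * fst (snd z) g x * snd (snd z) h)"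
proof -
  have "\<tau> (k \<otimes> (g \<otimes> h)) (lpush G k (rpush G h x)) =
      (\<Sum>z\<leftarrow>coact_left G H \<tau>. fst z k * snd z (g \<otimes> h) (rpush G h x))"
    by (rule coact_left_eq[OF \<tau> rpush_tangent[OF x]])
  also have "\<dots> = (\<Sum>z\<leftarrow>coact_left G H \<tau>. \<Sum>y\<leftarrow>coact_right G H (snd z). fst z k * (fst y g x * snd y h))"
  proof (intro arg_cong[where f = sum_list] map_cong refl)
    fix z assume "z \<in> set (coact_left G H \<tau>)"
    then have "snd z \<in> forms H" using coact_left_mem[OF \<tau>] by blast
    from coact_right_eq[OF this x, of h]
    show "fst z k * snd z (g \<otimes> h) (rpush G h x) =
        (\<Sum>y\<leftarrow>coact_right G H (snd z). fst z k * (fst y g x * snd y h))"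
      by (simp add: sum_list_const_mult)
  qed
  finally show ?thesis
    by (simp add: coact3_def sum_list_concat_map split_def o_def mult.assoc)
qed

lemma coact3_mem:
  assumes "\<tau> \<in> forms H" "z \<in> set (coact3 G H \<tau>)"
  shows "fst z \<in> H \<and> fst (snd z) \<in> forms H \<and> snd (snd z) \<in> H"
proof -
  obtain p q where "p \<in> set (coact_left G H \<tau>)" "q \<in> set (coact_right G H (snd p))"
    "z = (fst p, fst q, snd q)"
    using assms(2) by (auto simp: coact3_def split_def)
  with coact_left_mem[OF assms(1)] coact_right_mem[of "snd p" q] show ?thesis by auto
qed

section \<open>Twisting to first order\<close>

text \<open>This is what collapses Sweedler sums: a cochain applied to the legs of two coproducts is the cochain
  applied to the two contracted functions.\<close>

lemma bilin_sum_list: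
  assumes "\<And>b. b \<in> H \<Longrightarrow> lin_on H (\<lambda>a. B a b)" "\<And>a. a \<in> H \<Longrightarrow> lin_on H (B a)"
    and "\<And>z. z \<in> set zs \<Longrightarrow> u z \<in> H" "\<And>y. y \<in> set ys \<Longrightarrow> w y \<in> H"
  shows "(\<Sum>z\<leftarrow>zs. \<Sum>y\<leftarrow>ys. (c z * d y) * B (u z) (w y)) =
    B (\<lambda>h. \<Sum>z\<leftarrow>zs. c z * u z h) (\<lambda>h. \<Sum>y\<leftarrow>ys. d y * w y h)"
proof -
  let ?W = "\<lambda>h. \<Sum>y\<leftarrow>ys. d y * w y h"
  have W: "?W \<in> H" using assms(4) by (intro H_sum_list)
  have "(\<Sum>z\<leftarrow>zs. \<Sum>y\<leftarrow>ys. (c z * d y) * B (u z) (w y)) = (\<Sum>z\<leftarrow>zs. c z * B (u z) ?W)"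
    using assms(2-4) by (simp add: lin_sum_list mult.assoc sum_list_const_mult cong: map_cong)
  also have "\<dots> = B (\<lambda>h. \<Sum>z\<leftarrow>zs. c z * u z h) ?W"
    using lin_sum_list[OF assms(1)[OF W] assms(3), of zs] by simp
  finally show ?thesis .
qed

end

locale first_order_twist = hopf_functions G H
  for G :: "('g::{t2_space, second_countable_topology}, 'e::euclidean_space, 'm) lie_data_scheme"
    (structure) and H :: "('g \<Rightarrow> real) set" +
  fixes A A' :: "'g cochain2"
  assumes convolution_inverse: "convolution_inverse G H A A'"
    and leading: "a \<in> H \<Longrightarrow> b \<in> H \<Longrightarrow> fps_nth (A a b) 0 = a \<one> * b \<one>"
begin

abbreviation \<phi> :: "('g \<Rightarrow> real) \<Rightarrow> ('g \<Rightarrow> real) \<Rightarrow> real" where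
  "\<phi> a b \<equiv> fps_nth (A a b) 1"

lemma lin_on_cochain:
  "b \<in> H \<Longrightarrow> lin_on H (\<lambda>a. fps_nth (A a b) n)" "a \<in> H \<Longrightarrow> lin_on H (\<lambda>b. fps_nth (A a b) n)"
  "b \<in> H \<Longrightarrow> lin_on H (\<lambda>a. fps_nth (A' a b) n)" "a \<in> H \<Longrightarrow> lin_on H (\<lambda>b. fps_nth (A' a b) n)"
  using convolution_inverse by (auto simp: convolution_inverse_def bilinear_cochain_def lin_on_def)

lemma cochain_sum_list:
  assumes "\<And>z. z \<in> set zs \<Longrightarrow> u z \<in> H" "\<And>y. y \<in> set ys \<Longrightarrow> w y \<in> H"
  shows "(\<Sum>z\<leftarrow>zs. \<Sum>y\<leftarrow>ys. (c z * d y) * fps_nth (A (u z) (w y)) n) =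
      fps_nth (A (\<lambda>h. \<Sum>z\<leftarrow>zs. c z * u z h) (\<lambda>h. \<Sum>y\<leftarrow>ys. d y * w y h)) n"
    and "(\<Sum>z\<leftarrow>zs. \<Sum>y\<leftarrow>ys. (c z * d y) * fps_nth (A' (u z) (w y)) n) =
      fps_nth (A' (\<lambda>h. \<Sum>z\<leftarrow>zs. c z * u z h) (\<lambda>h. \<Sum>y\<leftarrow>ys. d y * w y h)) n"
  by (rule bilin_sum_list; use assms lin_on_cochain in blast)+

lemma inverse_leading: 
  assumes "a \<in> H" "b \<in> H" shows "fps_nth (A' a b) 0 = a \<one> * b \<one>"
proof -
  have "a \<one> * b \<one> = fps_nth (convolution G H A A' a b) 0"
    using convolution_inverse assms by (simp add: convolution_inverse_def)
  also have "\<dots> = (\<Sum>z\<leftarrow>coprod G H a. \<Sum>y\<leftarrow>coprod G H b.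
      (fst z \<one> * fst y \<one>) * fps_nth (A' (snd z) (snd y)) 0)"
    using coprod_mem[OF assms(1)] coprod_mem[OF assms(2)]
    by (simp add: convolution_def split_def fps_nth_sum_list leading cong: map_cong)
  also have "\<dots> = fps_nth (A' (\<lambda>h. \<Sum>z\<leftarrow>coprod G H a. fst z \<one> * snd z h)
      (\<lambda>h. \<Sum>y\<leftarrow>coprod G H b. fst y \<one> * snd y h)) 0"
    using coprod_mem[OF assms(1)] coprod_mem[OF assms(2)] by (intro cochain_sum_list(2)) auto
  also have "\<dots> = fps_nth (A' a b) 0"
    by (simp add: coprod_eq[OF assms(1), symmetric] coprod_eq[OF assms(2), symmetric])
  finally show ?thesis ..
qed

text \<open>The coefficient of \<open>\<hbar>\<close> in \<open>A * A' = \<epsilon> \<otimes> \<epsilon>\<close> is \<open>\<phi> + \<phi>'\<close>, as the leading terms are counits.\<close>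

lemma inverse_first_order: 
  assumes "a \<in> H" "b \<in> H" shows "fps_nth (A' a b) 1 = - \<phi> a b"
proof -
  note mem = coprod_mem[OF assms(1)] coprod_mem[OF assms(2)]
  have "0 = fps_nth (convolution G H A A' a b) 1"
    using convolution_inverse assms by (simp add: convolution_inverse_def)
  also have "\<dots> = (\<Sum>z\<leftarrow>coprod G H a. \<Sum>y\<leftarrow>coprod G H b.
      (fst z \<one> * fst y \<one>) * fps_nth (A' (snd z) (snd y)) 1 + (snd z \<one> * snd y \<one>) * \<phi> (fst z) (fst y))"
    using mem
    by (simp add: convolution_def split_def fps_nth_sum_list fps_mult_nth_1 leading inverse_leading mult_ac cong: map_cong)
  also have "\<dots> = (\<Sum>z\<leftarrow>coprod G H a. \<Sum>y\<leftarrow>coprod G H b.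
      (fst z \<one> * fst y \<one>) * fps_nth (A' (snd z) (snd y)) 1) + (\<Sum>z\<leftarrow>coprod G H a. \<Sum>y\<leftarrow>coprod G H b.
      (snd z \<one> * snd y \<one>) * \<phi> (fst z) (fst y))"
    by (simp add: sum_list_addf)
  also have "\<dots> = fps_nth (A' (\<lambda>h. \<Sum>z\<leftarrow>coprod G H a. fst z \<one> * snd z h)
      (\<lambda>h. \<Sum>y\<leftarrow>coprod G H b. fst y \<one> * snd y h)) 1 + \<phi> (\<lambda>h. \<Sum>z\<leftarrow>coprod G H a. snd z \<one> * fst z h)
      (\<lambda>h. \<Sum>y\<leftarrow>coprod G H b. snd y \<one> * fst y h)"
    using mem by (intro arg_cong2[where f = "(+)"] cochain_sum_list) auto
  also have "\<dots> = fps_nth (A' a b) 1 + \<phi> a b"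
    by (simp add: coprod_eq[OF assms(1), symmetric] coprod_eq[OF assms(2), symmetric]
        mult.commute[of "snd _ _"])
  finally show ?thesis by simp
qed

text \<open>Common form of the three twisted products: \<open>c\<close> and \<open>d\<close> are the values at a fixed point, or vector, of
  the middle legs. In first order either \<open>A\<close> contributes \<open>\<phi>\<close> and the last legs are evaluated at the
  unit, or \<open>A'\<close> contributes \<open>- \<phi>\<close> and the first legs are.\<close>

lemma twisted_sum:
  assumes "\<forall>z\<in>set zs. u z \<in> H \<and> u' z \<in> H" "\<forall>y\<in>set ys. w y \<in> H \<and> w' y \<in> H"
  shows "fps_nth (\<Sum>z\<leftarrow>zs. \<Sum>y\<leftarrow>ys. A (u z) (w y) * fps_const (c z * d y) * A' (u' z) (w' y)) 0 =
      (\<Sum>z\<leftarrow>zs. u z \<one> * c z * u' z \<one>) * (\<Sum>y\<leftarrow>ys. w y \<one> * d y * w' y \<one>)"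
    and "fps_nth (\<Sum>z\<leftarrow>zs. \<Sum>y\<leftarrow>ys. A (u z) (w y) * fps_const (c z * d y) * A' (u' z) (w' y)) 1 =
      \<phi> (\<lambda>h. \<Sum>z\<leftarrow>zs. u z h * c z * u' z \<one>) (\<lambda>h. \<Sum>y\<leftarrow>ys. w y h * d y * w' y \<one>)
      - \<phi> (\<lambda>h. \<Sum>z\<leftarrow>zs. u z \<one> * c z * u' z h) (\<lambda>h. \<Sum>y\<leftarrow>ys. w y \<one> * d y * w' y h)"
proof -
  show "fps_nth (\<Sum>z\<leftarrow>zs. \<Sum>y\<leftarrow>ys. A (u z) (w y) * fps_const (c z * d y) * A' (u' z) (w' y)) 0 =
      (\<Sum>z\<leftarrow>zs. u z \<one> * c z * u' z \<one>) * (\<Sum>y\<leftarrow>ys. w y \<one> * d y * w' y \<one>)"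
    using assms
    by (simp add: fps_nth_sum_list leading inverse_leading sum_list_times_sum_list mult_ac cong: map_cong)
  have "fps_nth (\<Sum>z\<leftarrow>zs. \<Sum>y\<leftarrow>ys. A (u z) (w y) * fps_const (c z * d y) * A' (u' z) (w' y)) 1 =
      (\<Sum>z\<leftarrow>zs. \<Sum>y\<leftarrow>ys. (c z * u' z \<one> * (d y * w' y \<one>)) * \<phi> (u z) (w y)
        - (c z * u z \<one> * (d y * w y \<one>)) * \<phi> (u' z) (w' y))"
    using assms
    by (simp add: fps_nth_sum_list fps_mult_nth_1 leading inverse_leading inverse_first_order[unfolded One_nat_def] mult_ac cong: map_cong)
  also have "\<dots> = (\<Sum>z\<leftarrow>zs. \<Sum>y\<leftarrow>ys. (c z * u' z \<one> * (d y * w' y \<one>)) * \<phi> (u z) (w y))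
      - (\<Sum>z\<leftarrow>zs. \<Sum>y\<leftarrow>ys. (c z * u z \<one> * (d y * w y \<one>)) * \<phi> (u' z) (w' y))"
    by (simp add: sum_list_subtractf)
  also have "\<dots> = \<phi> (\<lambda>h. \<Sum>z\<leftarrow>zs. c z * u' z \<one> * u z h) (\<lambda>h. \<Sum>y\<leftarrow>ys. d y * w' y \<one> * w y h)
      - \<phi> (\<lambda>h. \<Sum>z\<leftarrow>zs. c z * u z \<one> * u' z h) (\<lambda>h. \<Sum>y\<leftarrow>ys. d y * w y \<one> * w' y h)"
    using assms by (intro arg_cong2[where f = "(-)"] cochain_sum_list) auto
  finally show "fps_nth (\<Sum>z\<leftarrow>zs. \<Sum>y\<leftarrow>ys. A (u z) (w y) * fps_const (c z * d y) * A' (u' z) (w' y)) 1 =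
      \<phi> (\<lambda>h. \<Sum>z\<leftarrow>zs. u z h * c z * u' z \<one>) (\<lambda>h. \<Sum>y\<leftarrow>ys. w y h * d y * w' y \<one>)
      - \<phi> (\<lambda>h. \<Sum>z\<leftarrow>zs. u z \<one> * c z * u' z h) (\<lambda>h. \<Sum>y\<leftarrow>ys. w y \<one> * d y * w' y h)"
    by (simp add: mult_ac)
qed

lemma coprod3_ends: "a \<in> H \<Longrightarrow> \<forall>z\<in>set (coprod3 G H a). fst z \<in> H \<and> snd (snd z) \<in> H"
  using coprod3_mem by blast

lemma coact3_ends: "\<tau> \<in> forms H \<Longrightarrow> \<forall>z\<in>set (coact3 G H \<tau>). fst z \<in> H \<and> snd (snd z) \<in> H"
  using coact3_mem by blast

lemma coprod3_slices:
  assumes "a \<in> H"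
  shows "(\<Sum>z\<leftarrow>coprod3 G H a. fst z \<one> * fst (snd z) g * snd (snd z) \<one>) = a g"
    "(\<Sum>z\<leftarrow>coprod3 G H a. fst z h * fst (snd z) g * snd (snd z) \<one>) = a (h \<otimes> g)"
    "(\<Sum>z\<leftarrow>coprod3 G H a. fst z \<one> * fst (snd z) g * snd (snd z) h) = a (g \<otimes> h)"
  by (simp_all add: coprod3_eq[OF assms, symmetric])

lemma coact3_slices:
  assumes "\<tau> \<in> forms H" "x \<in> tangent G g"
  shows "(\<Sum>z\<leftarrow>coact3 G H \<tau>. fst z \<one> * fst (snd z) g x * snd (snd z) \<one>) = \<tau> g x"
    "(\<Sum>z\<leftarrow>coact3 G H \<tau>. fst z h * fst (snd z) g x * snd (snd z) \<one>) = \<tau> (h \<otimes> g) (lpush G h x)"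
    "(\<Sum>z\<leftarrow>coact3 G H \<tau>. fst z \<one> * fst (snd z) g x * snd (snd z) h) = \<tau> (g \<otimes> h) (rpush G h x)"
  by (simp_all add: coact3_eq[OF assms, symmetric])

lemma twist_mult_nth:
  assumes "a \<in> H" "b \<in> H"
  shows "fps_nth (twist_mult G H A A' a b g) 0 = a g * b g" (is "?l0 = ?r0")
    and "fps_nth (twist_mult G H A A' a b g) 1 =
       \<phi> (\<lambda>k. a (k \<otimes> g)) (\<lambda>k. b (k \<otimes> g)) - \<phi> (\<lambda>k. a (g \<otimes> k)) (\<lambda>k. b (g \<otimes> k))" (is "?l1 = ?r1")
proof -
  note S = twisted_sum[of "coprod3 G H a" fst "\<lambda>z. snd (snd z)" "coprod3 G H b" fst "\<lambda>y. snd (snd y)"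
      "\<lambda>z. fst (snd z) g" "\<lambda>y. fst (snd y) g", OF coprod3_ends[OF assms(1)] coprod3_ends[OF assms(2)]]
  show "?l0 = ?r0" "?l1 = ?r1"
    unfolding twist_mult_def split_def S coprod3_slices[OF assms(1)] coprod3_slices[OF assms(2)] by simp_all
qed

lemma twist_left_nth:
  assumes "a \<in> H" "\<tau> \<in> forms H" "x \<in> tangent G g"
  shows "fps_nth (twist_left G H A A' a \<tau> g x) 0 = a g * \<tau> g x" (is "?l0 = ?r0")
    and "fps_nth (twist_left G H A A' a \<tau> g x) 1 =
       \<phi> (\<lambda>k. a (k \<otimes> g)) (\<lambda>k. \<tau> (k \<otimes> g) (lpush G k x)) - \<phi> (\<lambda>k. a (g \<otimes> k)) (\<lambda>k. \<tau> (g \<otimes> k) (rpush G k x))" (is "?l1 = ?r1")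
proof -
  note S = twisted_sum[of "coprod3 G H a" fst "\<lambda>z. snd (snd z)" "coact3 G H \<tau>" fst "\<lambda>y. snd (snd y)"
      "\<lambda>z. fst (snd z) g" "\<lambda>y. fst (snd y) g x", OF coprod3_ends[OF assms(1)] coact3_ends[OF assms(2)]]
  show "?l0 = ?r0" "?l1 = ?r1"
    unfolding twist_left_def split_def S coprod3_slices[OF assms(1)] coact3_slices[OF assms(2,3)] by simp_all
qed

lemma twist_right_nth:
  assumes "a \<in> H" "\<tau> \<in> forms H" "x \<in> tangent G g"
  shows "fps_nth (twist_right G H A A' \<tau> a g x) 0 = \<tau> g x * a g" (is "?l0 = ?r0")
    and "fps_nth (twist_right G H A A' \<tau> a g x) 1 =
       \<phi> (\<lambda>k. \<tau> (k \<otimes> g) (lpush G k x)) (\<lambda>k. a (k \<otimes> g)) - \<phi> (\<lambda>k. \<tau> (g \<otimes> k) (rpush G k x)) (\<lambda>k. a (g \<otimes> k))" (is "?l1 = ?r1")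
proof -
  note S = twisted_sum[of "coact3 G H \<tau>" fst "\<lambda>z. snd (snd z)" "coprod3 G H a" fst "\<lambda>y. snd (snd y)"
      "\<lambda>z. fst (snd z) g x" "\<lambda>y. fst (snd y) g", OF coact3_ends[OF assms(2)] coprod3_ends[OF assms(1)]]
  show "?l0 = ?r0" "?l1 = ?r1"
    unfolding twist_right_def split_def S coprod3_slices[OF assms(1)] coact3_slices[OF assms(2,3)] by simp_all
qed

text \<open>The coefficient is a combination of products of middle legs for all vectors, tangent or not, so
  it is literally an element of \<^term>\<open>forms H\<close>.\<close>

lemma semiclassical_forms:
  assumes "a \<in> H" "\<tau> \<in> forms H"
  shows "semiclassical (twist_left G H A A') (twist_right G H A A') a \<tau> \<in> forms H"
proof -
  have nth: "fps_nth (s * fps_const c * t) 1 = fps_nth (s * t) 1 * c" for s t :: "real fps" and c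
  proof -
    have "s * fps_const c * t = fps_const c * (s * t)" by (simp only: mult_ac)
    then show ?thesis by (simp only: fps_mult_left_const_nth mult.commute)
  qed
  have scaled: "(\<lambda>g x. c * (fst (snd z) g * fst (snd y) g x)) \<in> forms H"
    "(\<lambda>g x. c * (fst (snd y) g x * fst (snd z) g)) \<in> forms H"
    if "z \<in> set (coprod3 G H a)" "y \<in> set (coact3 G H \<tau>)" for c z y
    using forms_scale[OF forms_mult_fun, of "fst (snd z)" "fst (snd y)" c] that
      coprod3_mem[OF assms(1)] coact3_mem[OF assms(2)]
    by (simp_all add: mult.commute[of "fst (snd y) _ _"])
  have "(\<lambda>g x. \<Sum>z\<leftarrow>coprod3 G H a. \<Sum>y\<leftarrow>coact3 G H \<tau>.
      fps_nth (A (fst z) (fst y) * A' (snd (snd z)) (snd (snd y))) 1 * (fst (snd z) g * fst (snd y) g x)) \<in> forms H"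
    by (intro forms_sum_list scaled)
  moreover have "(\<lambda>g x. \<Sum>y\<leftarrow>coact3 G H \<tau>. \<Sum>z\<leftarrow>coprod3 G H a.
      fps_nth (A (fst y) (fst z) * A' (snd (snd y)) (snd (snd z))) 1 * (fst (snd y) g x * fst (snd z) g)) \<in> forms H"
    by (intro forms_sum_list scaled)
  ultimately show ?thesis
    unfolding semiclassical_def twist_left_def twist_right_def split_def fps_sub_nth fps_nth_sum_list nth
    by (rule forms_diff)
qed

end

section \<open>Infinitesimal translations\<close>

text \<open>\<open>rder G v\<close> differentiates along the left invariant vector field of \<open>v\<close>, the generator of right
  translations; \<open>lder G v\<close> along the right invariant one. The versions for forms are the corresponding Lie
  derivatives.\<close>

definition rder :: "('g, 'm) monoid_scheme \<Rightarrow> 'g tvec \<Rightarrow> ('g \<Rightarrow> real) \<Rightarrow> 'g \<Rightarrow> real" where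
  "rder G v a g = v (\<lambda>k. a (g \<otimes>\<^bsub>G\<^esub> k))"

definition lder :: "('g, 'm) monoid_scheme \<Rightarrow> 'g tvec \<Rightarrow> ('g \<Rightarrow> real) \<Rightarrow> 'g \<Rightarrow> real" where
  "lder G v a g = v (\<lambda>k. a (k \<otimes>\<^bsub>G\<^esub> g))"

definition rder_form :: "('g, 'm) monoid_scheme \<Rightarrow> 'g tvec \<Rightarrow> 'g form \<Rightarrow> 'g form" where
  "rder_form G v \<tau> g x = v (\<lambda>k. \<tau> (g \<otimes>\<^bsub>G\<^esub> k) (rpush G k x))"

definition lder_form :: "('g, 'm) monoid_scheme \<Rightarrow> 'g tvec \<Rightarrow> 'g form \<Rightarrow> 'g form" where
  "lder_form G v \<tau> g x = v (\<lambda>k. \<tau> (k \<otimes>\<^bsub>G\<^esub> g) (lpush G k x))"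

context hopf_functions
begin

lemma H_rder: "v \<in> lie_alg G \<Longrightarrow> a \<in> H \<Longrightarrow> rder G v a \<in> H"
  unfolding rder_def by (intro H_right_convolve lin_on_lie_alg)

lemma H_lder: "v \<in> lie_alg G \<Longrightarrow> a \<in> H \<Longrightarrow> lder G v a \<in> H"
  unfolding lder_def by (intro H_left_convolve lin_on_lie_alg)

lemma rder_lin: "v \<in> lie_alg G \<Longrightarrow> a \<in> H \<Longrightarrow> b \<in> H \<Longrightarrow>
    rder G v (\<lambda>h. \<alpha> * a h + \<beta> * b h) g = \<alpha> * rder G v a g + \<beta> * rder G v b g"
  unfolding rder_def by (intro lin_onD[of H] lin_on_lie_alg H_left_translate)

lemma lder_lin: "v \<in> lie_alg G \<Longrightarrow> a \<in> H \<Longrightarrow> b \<in> H \<Longrightarrow>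
    lder G v (\<lambda>h. \<alpha> * a h + \<beta> * b h) g = \<alpha> * lder G v a g + \<beta> * lder G v b g"
  unfolding lder_def by (intro lin_onD[of H] lin_on_lie_alg H_right_translate)

lemma rder_mult: "v \<in> lie_alg G \<Longrightarrow> a \<in> H \<Longrightarrow> b \<in> H \<Longrightarrow>
    rder G v (\<lambda>h. a h * b h) g = a g * rder G v b g + rder G v a g * b g"
  unfolding rder_def by (subst lie_alg_mult) (auto intro: H_left_translate)

lemma lder_mult: "v \<in> lie_alg G \<Longrightarrow> a \<in> H \<Longrightarrow> b \<in> H \<Longrightarrow>
    lder G v (\<lambda>h. a h * b h) g = a g * lder G v b g + lder G v a g * b g"
  unfolding lder_def by (subst lie_alg_mult) (auto intro: H_right_translate)

lemma rder_form_lin: "v \<in> lie_alg G \<Longrightarrow> \<sigma> \<in> forms H \<Longrightarrow> \<tau> \<in> forms H \<Longrightarrow> x \<in> tangent G g \<Longrightarrow>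
    rder_form G v (\<lambda>h y. \<alpha> * \<sigma> h y + \<beta> * \<tau> h y) g x = \<alpha> * rder_form G v \<sigma> g x + \<beta> * rder_form G v \<tau> g x"
  unfolding rder_form_def by (intro lin_onD[of H] lin_on_lie_alg H_form_right_translate)

lemma lder_form_lin: "v \<in> lie_alg G \<Longrightarrow> \<sigma> \<in> forms H \<Longrightarrow> \<tau> \<in> forms H \<Longrightarrow> x \<in> tangent G g \<Longrightarrow>
    lder_form G v (\<lambda>h y. \<alpha> * \<sigma> h y + \<beta> * \<tau> h y) g x = \<alpha> * lder_form G v \<sigma> g x + \<beta> * lder_form G v \<tau> g x"
  unfolding lder_form_def by (intro lin_onD[of H] lin_on_lie_alg H_form_left_translate)

lemma rder_form_mult: "v \<in> lie_alg G \<Longrightarrow> b \<in> H \<Longrightarrow> \<tau> \<in> forms H \<Longrightarrow> x \<in> tangent G g \<Longrightarrow>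
    rder_form G v (\<lambda>h y. b h * \<tau> h y) g x = b g * rder_form G v \<tau> g x + rder G v b g * \<tau> g x"
  unfolding rder_form_def rder_def
  by (subst lie_alg_mult) (auto intro: H_left_translate H_form_right_translate)

lemma lder_form_mult: "v \<in> lie_alg G \<Longrightarrow> b \<in> H \<Longrightarrow> \<tau> \<in> forms H \<Longrightarrow> x \<in> tangent G g \<Longrightarrow>
    lder_form G v (\<lambda>h y. b h * \<tau> h y) g x = b g * lder_form G v \<tau> g x + lder G v b g * \<tau> g x"
  unfolding lder_form_def lder_def
  by (subst lie_alg_mult) (auto intro: H_right_translate H_form_left_translate)

text \<open>The Lie derivative commutes with \<open>d\<close>.\<close>

lemma rder_form_dform: "v \<in> lie_alg G \<Longrightarrow> b \<in> H \<Longrightarrow> x \<in> tangent G g \<Longrightarrow>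
    rder_form G v (dform b) g x = x (rder G v b)"
  unfolding rder_form_def rder_def[abs_def] dform_def rpush_def
  by (rule lin_exchange[symmetric]) (auto intro: lin_on_tangent lin_on_lie_alg)

lemma lder_form_dform: "v \<in> lie_alg G \<Longrightarrow> b \<in> H \<Longrightarrow> x \<in> tangent G g \<Longrightarrow>
    lder_form G v (dform b) g x = x (lder G v b)"
  unfolding lder_form_def lder_def[abs_def] dform_def lpush_def
  by (rule lin_exchange) (auto intro: lin_on_tangent lin_on_lie_alg)

text \<open>The signs come from the inverse in the group actions.\<close>

lemma infinitesimal_actions:
  assumes "v \<in> lie_alg G" "a \<in> H"
  shows "fun_lie_act G a v h = - rder G v a h" "lie_act_fun G v a h = - lder G v a h"
  using lie_alg_inv[OF assms(1) H_left_translate[OF assms(2)], of h]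
    lie_alg_inv[OF assms(1) H_right_translate[OF assms(2)], of h]
  by (simp_all add: fun_lie_act_def fun_act_def rder_def lie_act_fun_def act_fun_def lder_def)

lemma infinitesimal_actions_form:
  assumes "v \<in> lie_alg G" "\<tau> \<in> forms H" "x \<in> tangent G h"
  shows "form_lie_act G \<tau> v h x = - rder_form G v \<tau> h x"
    "lie_act_form G v \<tau> h x = - lder_form G v \<tau> h x"
  using lie_alg_inv[OF assms(1) H_form_right_translate[OF assms(2,3)]]
    lie_alg_inv[OF assms(1) H_form_left_translate[OF assms(2,3)]]
  by (simp_all add: form_lie_act_def form_act_def rder_form_def lie_act_form_def act_form_def lder_form_def)

lemma H_left_triv: "\<tau> \<in> forms H \<Longrightarrow> z \<in> lie_alg G \<Longrightarrow> (\<lambda>h. left_triv G \<tau> h z) \<in> H"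
  using H_form_left_translate[of \<tau> z \<one>] by (simp add: left_triv_def lie_alg_def)

text \<open>Left translations preserve left invariant vector fields, so no bracket appears here, in contrast to
  \<open>rder_form_lpush\<close>.\<close>

lemma lder_left_triv:
  "lder G w (\<lambda>h. left_triv G \<tau> h z) g = lder_form G w \<tau> g (lpush G g z)"
  by (simp add: lder_def lder_form_def left_triv_def lpush_lpush)

lemma lhat_eq_rder: "lhat G a g v = rder G v a g"
  by (simp add: lhat_def lpush_def rder_def)

text \<open>The Lie derivative of \<open>\<tau>\<close> along the left invariant field \<open>W\<close> of \<open>w\<close> satisfies
  \<open>(L\<^sub>W \<tau>)(Z) = W(\<tau>(Z)) - \<tau>([W, Z])\<close>, here with \<open>Z\<close> the left invariant field of \<open>z\<close>. Both sides obey the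
  same product rule, so exact forms decide, for which it is the definition of the bracket.\<close>

lemma rder_form_lpush:
  assumes z: "z \<in> lie_alg G" and w: "w \<in> lie_alg G" and "\<tau> \<in> forms H"
  shows "rder_form G w \<tau> g (lpush G g z) =
    rder G w (\<lambda>h. left_triv G \<tau> h z) g + left_triv G \<tau> g (lie_bracket G z w)"
  using assms(3)
proof (induction rule: forms_induct)
  case zero
  show ?case
    using tangent_const[of w \<one> 0] w by (simp add: rder_form_def rder_def left_triv_def lie_alg_def)
next
  case (step c b \<sigma>)
  note gz = lpush_lie_alg[OF z, of g]
  note db = forms_dform[OF step(2)] and cdb = forms_mult_fun[OF step(1) forms_dform[OF step(2)]]
  have bg: "(\<lambda>h. b (g \<otimes> h)) \<in> H" by (rule H_left_translate[OF step(2)])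
  have "rder_form G w (dform b) g (lpush G g z) - rder G w (\<lambda>h. left_triv G (dform b) h z) g =
      lie_bracket G z w (\<lambda>h. b (g \<otimes> h))"
    using lin_exchange[OF lin_on_lie_alg[OF z] lin_on_lie_alg[OF w] bg] H_smooth[OF bg]
    by (simp add: rder_form_def rder_def left_triv_def dform_def rpush_def lpush_def lie_bracket_def)
  then have base: "rder_form G w (dform b) g (lpush G g z) =
      rder G w (\<lambda>h. left_triv G (dform b) h z) g + left_triv G (dform b) g (lie_bracket G z w)"
    by (simp add: left_triv_def dform_def lpush_def)
  have "rder_form G w (\<lambda>h y. c h * dform b h y + \<sigma> h y) g (lpush G g z) =
      c g * rder_form G w (dform b) g (lpush G g z) + rder G w c g * dform b g (lpush G g z)
      + rder_form G w \<sigma> g (lpush G g z)"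
    using rder_form_lin[OF w cdb step(3) gz, of 1 1] rder_form_mult[OF w step(1) db gz] by simp
  moreover have "rder G w (\<lambda>h. left_triv G (\<lambda>h y. c h * dform b h y + \<sigma> h y) h z) g =
      c g * rder G w (\<lambda>h. left_triv G (dform b) h z) g + rder G w c g * dform b g (lpush G g z)
      + rder G w (\<lambda>h. left_triv G \<sigma> h z) g"
    using rder_lin[OF w H_mult[OF step(1) H_left_triv[OF db z]] H_left_triv[OF step(3) z], of 1 1]
      rder_mult[OF w step(1) H_left_triv[OF db z]]
    by (simp add: left_triv_def)
  ultimately show ?case
    using base step(4) by (simp add: left_triv_def algebra_simps)
qed

end

section \<open>The semiclassical limit\<close>

lemma O_hbar2_iff: "O_hbar2 s \<longleftrightarrow> fps_nth s 0 = 0 \<and> fps_nth s 1 = 0"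
proof
  assume "O_hbar2 s"
  then obtain t where "s = fps_X ^ 2 * t" by (auto simp: O_hbar2_def)
  then show "fps_nth s 0 = 0 \<and> fps_nth s 1 = 0"
    by (simp add: fps_X_power_mult_nth)
next
  assume s: "fps_nth s 0 = 0 \<and> fps_nth s 1 = 0"
  have "s = fps_X ^ 2 * Abs_fps (\<lambda>n. fps_nth s (n + 2))"
  proof (rule fps_ext)
    fix n show "fps_nth s n = fps_nth (fps_X ^ 2 * Abs_fps (\<lambda>n. fps_nth s (n + 2))) n"
    proof (cases "n < 2")
      case True
      then show ?thesis using s by (auto simp: fps_X_power_mult_nth less_2_cases_iff)
    next
      case False
      then have "n - 2 + 2 = n" by simp
      then show ?thesis using False by (simp add: fps_X_power_mult_nth del: add_2_eq_Suc')
    qed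
  qed
  then show "O_hbar2 s" unfolding O_hbar2_def by (rule dvdI)
qed

text \<open>The assumptions are what the choice of \<open>F\<close> contributes: its antisymmetric part to first order is
  \<open>r\<^sub>-\<close>, and the twisted product of functions quantises \<open>P\<close>.\<close>

locale semiclassical_twist = first_order_twist G H A A'
  for G :: "('g::{t2_space, second_countable_topology}, 'e::euclidean_space, 'm) lie_data_scheme"
    (structure) and H :: "('g \<Rightarrow> real) set" and A A' :: "'g cochain2" +
  fixes P :: "('g \<Rightarrow> real) \<Rightarrow> ('g \<Rightarrow> real) \<Rightarrow> 'g \<Rightarrow> real" and r :: "'g lie2"
  assumes r_elem: "r \<in> lie2_elems G"
    and antisymmetrised: "a \<in> H \<Longrightarrow> b \<in> H \<Longrightarrow> \<phi> b a - \<phi> a b = teval (\<lambda>(v, w). v a * w b) (r_minus r)"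
    and quantised: "quantises H P (twist_mult G H A A')"
begin

abbreviation \<gamma> :: "('g \<Rightarrow> real) \<Rightarrow> 'g form \<Rightarrow> 'g form" where
  "\<gamma> \<equiv> semiclassical (twist_left G H A A') (twist_right G H A A')"

text \<open>The contribution of an elementary tensor \<open>v \<otimes> w\<close> of \<open>r\<^sub>-\<close> to the Poisson bracket, and below to the
  preconnection. Identities between these are checked tensor by tensor, and linearity does the rest.\<close>

definition bracket_term :: "('g \<Rightarrow> real) \<Rightarrow> ('g \<Rightarrow> real) \<Rightarrow> 'g \<Rightarrow> 'g tvec \<times> 'g tvec \<Rightarrow> real" where
  "bracket_term a b g = (\<lambda>(v, w). rder G v a g * rder G w b g - lder G v a g * lder G w b g)"

definition connection_term :: "('g \<Rightarrow> real) \<Rightarrow> 'g form \<Rightarrow> 'g \<Rightarrow> 'g tvec \<Rightarrow> 'g tvec \<times> 'g tvec \<Rightarrow> real" where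
  "connection_term a \<tau> g x = (\<lambda>(v, w). rder G v a g * rder_form G w \<tau> g x - lder G v a g * lder_form G w \<tau> g x)"

lemma r_minus_lie_alg: "(v, w) \<in> Poly_Mapping.keys (r_minus r) \<Longrightarrow> v \<in> lie_alg G \<and> w \<in> lie_alg G"
  using r_minus_keys[OF r_elem] by auto

text \<open>The Poisson bracket, being the first order part of the commutator, comes from the twist by the same
  formula as the preconnection.\<close>

lemma bracket_eq:
  assumes "a \<in> H" "b \<in> H"
  shows "P a b g = teval (bracket_term a b g) (r_minus r)"
proof -
  have "O_hbar2 (twist_mult G H A A' a b g - twist_mult G H A A' b a g - fps_X * fps_const (P a b g))"
    using quantised assms by (simp add: quantises_def)
  then have "P a b g = fps_nth (twist_mult G H A A' a b g) 1 - fps_nth (twist_mult G H A A' b a g) 1"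
    by (simp add: O_hbar2_iff)
  also have "\<dots> = (\<phi> (\<lambda>k. b (g \<otimes> k)) (\<lambda>k. a (g \<otimes> k)) - \<phi> (\<lambda>k. a (g \<otimes> k)) (\<lambda>k. b (g \<otimes> k)))
      - (\<phi> (\<lambda>k. b (k \<otimes> g)) (\<lambda>k. a (k \<otimes> g)) - \<phi> (\<lambda>k. a (k \<otimes> g)) (\<lambda>k. b (k \<otimes> g)))"
    unfolding twist_mult_nth[OF assms] twist_mult_nth[OF assms(2,1)] by simp
  also have "\<dots> = teval (bracket_term a b g) (r_minus r)"
    unfolding antisymmetrised[OF H_left_translate[OF assms(1)] H_left_translate[OF assms(2)]]
      antisymmetrised[OF H_right_translate[OF assms(1)] H_right_translate[OF assms(2)]]
      teval_diff_fun[symmetric]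
    by (intro teval_cong) (auto simp: bracket_term_def rder_def lder_def)
  finally show ?thesis .
qed

lemma connection_eq:
  assumes "a \<in> H" "\<tau> \<in> forms H" "x \<in> tangent G g"
  shows "\<gamma> a \<tau> g x = teval (connection_term a \<tau> g x) (r_minus r)"
proof -
  have "\<gamma> a \<tau> g x = fps_nth (twist_left G H A A' a \<tau> g x) 1 - fps_nth (twist_right G H A A' \<tau> a g x) 1"
    by (simp add: semiclassical_def)
  also have "\<dots> = (\<phi> (\<lambda>k. \<tau> (g \<otimes> k) (rpush G k x)) (\<lambda>k. a (g \<otimes> k)) - \<phi> (\<lambda>k. a (g \<otimes> k)) (\<lambda>k. \<tau> (g \<otimes> k) (rpush G k x)))
      - (\<phi> (\<lambda>k. \<tau> (k \<otimes> g) (lpush G k x)) (\<lambda>k. a (k \<otimes> g)) - \<phi> (\<lambda>k. a (k \<otimes> g)) (\<lambda>k. \<tau> (k \<otimes> g) (lpush G k x)))"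
    unfolding twist_left_nth[OF assms] twist_right_nth[OF assms] by simp
  also have "\<dots> = teval (connection_term a \<tau> g x) (r_minus r)"
    unfolding antisymmetrised[OF H_left_translate[OF assms(1)] H_form_right_translate[OF assms(2,3)]]
      antisymmetrised[OF H_right_translate[OF assms(1)] H_form_left_translate[OF assms(2,3)]]
      teval_diff_fun[symmetric]
    by (intro teval_cong) (auto simp: connection_term_def rder_def lder_def rder_form_def lder_form_def)
  finally show ?thesis .
qed

lemma gamma_r_eq:
  assumes "a \<in> H" "\<tau> \<in> forms H" "x \<in> tangent G g"
  shows "gamma_r G r a \<tau> g x = \<gamma> a \<tau> g x"
  unfolding connection_eq[OF assms] gamma_r_def
  by (intro teval_cong)
     (auto simp: connection_term_def infinitesimal_actions infinitesimal_actions_form assms dest!: r_minus_lie_alg)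

text \<open>Applying \<open>x\<close> to a product of derivatives of \<open>a\<close> and \<open>b\<close> gives a term with \<open>db\<close> and one with
  \<open>da\<close>. The latter is a summand of \<open>\<gamma> b (da)\<close> with \<open>v\<close> and \<open>w\<close> exchanged, whence the minus sign by
  antisymmetry of \<open>r\<^sub>-\<close>.\<close>

lemma d_bracket:
  assumes a: "a \<in> H" and b: "b \<in> H" and x: "x \<in> tangent G g"
  shows "x (P a b) = \<gamma> a (dform b) g x - \<gamma> b (dform a) g x"
proof -
  have deriv: "x (\<lambda>g. bracket_term a b g p) =
      connection_term a (dform b) g x p + connection_term b (dform a) g x (prod.swap p)"
    and H: "(\<lambda>g. bracket_term a b g p) \<in> H" if "p \<in> Poly_Mapping.keys (r_minus r)" for p
  proof -
    obtain v w where p: "p = (v, w)" by fastforce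
    have v: "v \<in> lie_alg G" and w: "w \<in> lie_alg G" using r_minus_lie_alg that p by auto
    note mem = H_rder[OF v a] H_rder[OF w b] H_lder[OF v a] H_lder[OF w b]
    note prods = H_mult[OF mem(1,2)] H_mult[OF mem(3,4)]
    show "(\<lambda>g. bracket_term a b g p) \<in> H"
      using H_lin[OF prods, of 1 "-1"] by (simp add: bracket_term_def p)
    show "x (\<lambda>g. bracket_term a b g p) =
        connection_term a (dform b) g x p + connection_term b (dform a) g x (prod.swap p)"
      using lin_onD[OF lin_on_tangent[OF x] prods, of 1 "-1"] tangent_mult[OF x mem(1,2)] tangent_mult[OF x mem(3,4)]
      by (simp add: bracket_term_def connection_term_def p rder_form_dform[OF v a x] rder_form_dform[OF w b x]
          lder_form_dform[OF v a x] lder_form_dform[OF w b x] algebra_simps)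
  qed
  have "x (P a b) = x (\<lambda>g. teval (\<lambda>p. bracket_term a b g p) (r_minus r))"
    by (intro arg_cong[of _ _ x] ext) (simp add: bracket_eq[OF a b])
  also have "\<dots> = teval (\<lambda>p. x (\<lambda>g. bracket_term a b g p)) (r_minus r)"
    by (rule lin_teval[OF lin_on_tangent[OF x] H])
  also have "\<dots> = teval (\<lambda>p. 1 * connection_term a (dform b) g x p
      + 1 * connection_term b (dform a) g x (prod.swap p)) (r_minus r)"
    by (intro teval_cong) (simp add: deriv)
  also have "\<dots> = \<gamma> a (dform b) g x - \<gamma> b (dform a) g x"
    unfolding teval_lin teval_r_minus_swap
    by (simp add: connection_eq[OF a forms_dform[OF b] x] connection_eq[OF b forms_dform[OF a] x])
  finally show ?thesis .
qed

lemma preconnection: "preconnection G H P \<gamma>"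
proof -
  have lin1: "\<gamma> (\<lambda>g. \<alpha> * a g + \<beta> * b g) \<tau> g x = \<alpha> * \<gamma> a \<tau> g x + \<beta> * \<gamma> b \<tau> g x"
    if "a \<in> H" "b \<in> H" "\<tau> \<in> forms H" "x \<in> tangent G g" for a b \<tau> \<alpha> \<beta> g x
    unfolding connection_eq[OF that(1,3,4)] connection_eq[OF that(2,3,4)]
      connection_eq[OF H_lin[OF that(1,2)] that(3,4)] teval_lin[symmetric]
    by (intro teval_cong)
       (auto simp: connection_term_def rder_lin lder_lin that algebra_simps dest!: r_minus_lie_alg)
  have lin2: "\<gamma> a (\<lambda>g x. \<alpha> * \<sigma> g x + \<beta> * \<tau> g x) g x = \<alpha> * \<gamma> a \<sigma> g x + \<beta> * \<gamma> a \<tau> g x"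
    if "a \<in> H" "\<sigma> \<in> forms H" "\<tau> \<in> forms H" "x \<in> tangent G g" for a \<sigma> \<tau> \<alpha> \<beta> g x
    unfolding connection_eq[OF that(1,2,4)] connection_eq[OF that(1,3,4)]
      connection_eq[OF that(1) forms_lin[OF that(2,3)] that(4)] teval_lin[symmetric]
    by (intro teval_cong)
       (auto simp: connection_term_def rder_form_lin lder_form_lin that algebra_simps dest!: r_minus_lie_alg)
  have leib1: "\<gamma> (\<lambda>g. a g * b g) \<tau> g x = a g * \<gamma> b \<tau> g x + \<gamma> a \<tau> g x * b g"
    if "a \<in> H" "b \<in> H" "\<tau> \<in> forms H" "x \<in> tangent G g" for a b \<tau> g x
    unfolding connection_eq[OF that(1,3,4)] connection_eq[OF that(2,3,4)]
      connection_eq[OF H_mult[OF that(1,2)] that(3,4)] mult.commute[of _ "b g"] teval_lin[symmetric]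
    by (intro teval_cong)
       (auto simp: connection_term_def rder_mult lder_mult that algebra_simps dest!: r_minus_lie_alg)
  have leib2: "\<gamma> a (\<lambda>g x. b g * \<tau> g x) g x = b g * \<gamma> a \<tau> g x + P a b g * \<tau> g x"
    if "a \<in> H" "b \<in> H" "\<tau> \<in> forms H" "x \<in> tangent G g" for a b \<tau> g x
    unfolding connection_eq[OF that(1,3,4)] bracket_eq[OF that(1,2)]
      connection_eq[OF that(1) forms_mult_fun[OF that(2,3)] that(4)] mult.commute[of _ "\<tau> g x"] teval_lin[symmetric]
    by (intro teval_cong)
       (auto simp: connection_term_def bracket_term_def rder_form_mult lder_form_mult that algebra_simps
         dest!: r_minus_lie_alg)
  show ?thesis
    unfolding preconnection_def form_eq_def
    by (auto simp: semiclassical_forms lin1 lin2 leib1 leib2 d_bracket[folded dform_def] dform_def)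
qed

text \<open>The two left invariant contributions differ by the bracket of \<open>rder_form_lpush\<close>, the right
  invariant ones agree by \<open>lder_left_triv\<close>; the difference is the \<open>\<Xi>\<close> with \<open>xi_hat = 0\<close>.\<close>

lemma left_triv_connection:
  assumes a: "a \<in> H" and \<tau>: "\<tau> \<in> forms H" and z: "z \<in> lie_alg G"
  shows "left_triv G (\<gamma> a \<tau>) g z = P a (\<lambda>h. left_triv G \<tau> h z) g +
    teval (\<lambda>(v, w). lhat G a g v * ad_star G w (left_triv G \<tau> g) z) (r_minus r)"
proof -
  have "left_triv G (\<gamma> a \<tau>) g z = teval (connection_term a \<tau> g (lpush G g z)) (r_minus r)"
    unfolding left_triv_def by (rule connection_eq[OF a \<tau> lpush_lie_alg[OF z]])
  also have "\<dots> = teval (\<lambda>p. 1 * bracket_term a (\<lambda>h. left_triv G \<tau> h z) g p +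
      1 * (case p of (v, w) \<Rightarrow> lhat G a g v * ad_star G w (left_triv G \<tau> g) z)) (r_minus r)"
    by (intro teval_cong)
       (auto simp: connection_term_def bracket_term_def rder_form_lpush[OF z _ \<tau>] lder_left_triv
         lhat_eq_rder ad_star_def algebra_simps dest!: r_minus_lie_alg)
  also have "\<dots> = P a (\<lambda>h. left_triv G \<tau> h z) g +
      teval (\<lambda>(v, w). lhat G a g v * ad_star G w (left_triv G \<tau> g) z) (r_minus r)"
    unfolding teval_lin by (simp add: bracket_eq[OF a H_left_triv[OF \<tau> z]])
  finally show ?thesis .
qed

lemma canonical: "canonical_preconnection G H P r \<gamma>"
proof -
  let ?\<Xi> = "\<lambda>\<phi> \<psi> z. teval (\<lambda>(v, w). \<phi> v * ad_star G w \<psi> z) (r_minus r)"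
  have "has_xi G H P \<gamma> ?\<Xi>"
    by (simp add: has_xi_def left_triv_connection)
  then show ?thesis
    unfolding canonical_preconnection_def xi_hat_def
    by (intro conjI preconnection exI[of _ ?\<Xi>]) auto
qed

lemma commutator:
  assumes "a \<in> H" "\<tau> \<in> forms H" "x \<in> tangent G h"
  shows "O_hbar2 (twist_left G H A A' a \<tau> h x - twist_right G H A A' \<tau> a h x
    - fps_X * fps_const (gamma_r G r a \<tau> h x))"
  using twist_left_nth(1)[OF assms] twist_right_nth(1)[OF assms]
  by (simp add: O_hbar2_iff gamma_r_eq[OF assms] semiclassical_def)

end

theorem proposition5p3:
  fixes G :: "('g::{t2_space, second_countable_topology}, 'e::euclidean_space, 'm) lie_data_scheme"
    and H :: "('g \<Rightarrow> real) set"
    and P :: "('g \<Rightarrow> real) \<Rightarrow> ('g \<Rightarrow> real) \<Rightarrow> 'g \<Rightarrow> real"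
    and r :: "'g lie2"
    and F :: "nat \<Rightarrow> 'g utens" and f :: "'g utens"
    and \<F> \<F>' R :: "'g cochain2"
  assumes "lie_group G"
    and "quasitriangular_poisson_lie G P r"
    and "function_hopf_algebra G H"
    and "\<forall>n. F n \<in> U_elems G 2" and "f \<in> U_elems G 2"
    and "U_eq G 2 (F 0) U_one2" and "U_eq G 2 (F 1) f"
    and "U_eq G 2 (lie2_U r) (U_flip f - f + lie2_U (r_plus r))"
    and "\<F> = series_pair G F"
    and "\<forall>a\<in>H. \<F> (\<lambda>g. 1) a = fps_const (a \<one>\<^bsub>G\<^esub>)"
    and "convolution_inverse G H \<F> \<F>'"
    and "coquasitriangular G H (twist_mult G H \<F> \<F>') R"
    and "quantises H P (twist_mult G H \<F> \<F>')"
    and "quantises_r G H r R"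
  shows "canonical_preconnection G H P r
      (semiclassical (twist_left G H \<F> \<F>') (twist_right G H \<F> \<F>'))
    \<and> (\<forall>a\<in>H. \<forall>\<tau>\<in>forms H. \<forall>h. \<forall>x\<in>tangent G h.
        O_hbar2 (twist_left G H \<F> \<F>' a \<tau> h x - twist_right G H \<F> \<F>' \<tau> a h x
          - fps_X * fps_const (gamma_r G r a \<tau> h x)))"
proof -
  interpret lie_group G by fact
  interpret hopf_functions G H by unfold_locales fact
  have nth: "fps_nth (\<F> a b) n = pair2 a b (F n)" for a b n
    by (simp add: assms(9) series_pair_def pair2_def)
  \<comment> \<open>Subtracting \<open>r\<^sub>+\<close> from the hypothesis on \<open>r\<close> leaves \<open>r\<^sub>- = f\<^sub>2\<^sub>1 - f\<close>.\<close>
  have r_minus: "pair2 b a f - pair2 a b f = teval (\<lambda>(v, w). v a * w b) (r_minus r)"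
    if "a \<in> H" "b \<in> H" for a b
  proof -
    let ?B = "\<lambda>(v, w). v a * w b"
    have "teval ?B r = pair2 a b (U_flip f - f + lie2_U (r_plus r))"
      using pair2_U_eq[OF assms(8) that] by (simp add: pair2_lie2_U)
    also have "\<dots> = pair2 b a f - pair2 a b f + teval ?B (r_plus r)"
      by (simp add: pair2_add pair2_diff pair2_flip[OF assms(5)] pair2_lie2_U)
    finally show ?thesis by (simp add: teval_r_plus teval_r_minus field_simps)
  qed
  interpret semiclassical_twist G H \<F> \<F>' P r
  proof unfold_locales
    show "convolution_inverse G H \<F> \<F>'" "quantises H P (twist_mult G H \<F> \<F>')" by fact+
    show "r \<in> lie2_elems G" using assms(2) by (simp add: quasitriangular_poisson_lie_def)
    show "fps_nth (\<F> a b) 0 = a \<one>\<^bsub>G\<^esub> * b \<one>\<^bsub>G\<^esub>" if "a \<in> H" "b \<in> H" for a b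
      using pair2_U_eq[OF assms(6) that] by (simp add: nth pair2_one2)
    show "fps_nth (\<F> b a) 1 - fps_nth (\<F> a b) 1 = teval (\<lambda>(v, w). v a * w b) (r_minus r)"
      if "a \<in> H" "b \<in> H" for a b
      using r_minus[OF that] pair2_U_eq[OF assms(7)] that by (simp add: nth)
  qed
  show ?thesis using canonical commutator by blast
qed

end
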